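(* In the adjacency-list model augmented with $\texttt{IN-SORTED}$, the single-node problem can be solved in $\tilde O(n)$ expected time for every target $t$.
   Context: Let $G=(V,E)$ be a directed graph with $n=|V|$ nodes. Fix a constant $\alpha\in(0,1)$. An $\alpha$-discounted random walk from $s$: at each step, with probability $\alpha$ it terminates at the current node, otherwise it moves to a uniformly random out-neighbor of the current node. $\pi(s,t)$ is the probability that such a walk from $s$ terminates at $t$, and $\pi(t)=\frac1n\sum_{s\in V}\pi(s,t)$. Adjacency-list model: an algorithm accesses $G$ only through constant-time queries $\texttt{DEG-IN}(u)$, $\texttt{DEG-OUT}(u)$ (in-/out-degree of $u$), $\texttt{IN}(u,i)$, $\texttt{OUT}(u,i)$ ($i$-th in-/out-neighbor of $u$); additionally $\texttt{IN-SORTED}(u,i)$ returns the $i$-th in-neighbor of $u$ when in-neighbors are sorted by out-degree. Single-node problem: given $G$ (via queries) and a target $t\in V$, output $\hat\pi(t)$ with $\Pr\{|\hat\pi(t)-\pi(t)|\ge\varepsilon\pi(t)\}\le p_f$, where $\varepsilon,p_f$ are fixed small constants. $\tilde O$ suppresses polylogarithmic factors in $n$. *)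

theory Defs
  imports
    "HOL-Probability.Probability"
    "HOL-Library.Landau_Symbols"
    "Graph_Theory.Pair_Digraph"
begin

primrec chain :: "('s \<Rightarrow> 's pmf) \<Rightarrow> nat \<Rightarrow> 's \<Rightarrow> 's pmf" where
  "chain K 0 s = return_pmf s"
| "chain K (Suc k) s = bind_pmf (chain K k s) K"

section \<open>Discounted random walks and PageRank\<close>

datatype 'a walk_state = At 'a | Stopped 'a

text \<open>At a node without out-neighbours the walk cannot move, so it terminates there.\<close>

fun walk_step :: "real \<Rightarrow> 'a pair_pre_digraph \<Rightarrow> 'a walk_state \<Rightarrow> 'a walk_state pmf" where
  "walk_step \<alpha> G (Stopped u) = return_pmf (Stopped u)"
| "walk_step \<alpha> G (At u) =
     bind_pmf (bernoulli_pmf \<alpha>) (\<lambda>stop.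
       if stop \<or> {v. u \<rightarrow>\<^bsub>G\<^esub> v} = {} then return_pmf (Stopped u)
       else map_pmf At (pmf_of_set {v. u \<rightarrow>\<^bsub>G\<^esub> v}))"

text \<open>The events that the walk has terminated at \<open>t\<close> within \<open>k\<close> steps increase with \<open>k\<close>; their union is
  the event that the walk terminates at \<open>t\<close>.\<close>

definition ppr :: "real \<Rightarrow> 'a pair_pre_digraph \<Rightarrow> 'a \<Rightarrow> 'a \<Rightarrow> real" where
  "ppr \<alpha> G s t = (SUP k. pmf (chain (walk_step \<alpha> G) k (At s)) (Stopped t))"

definition pagerank :: "real \<Rightarrow> 'a pair_pre_digraph \<Rightarrow> 'a \<Rightarrow> real" where
  "pagerank \<alpha> G t = (\<Sum>s\<in>pverts G. ppr \<alpha> G s t) / real (card (pverts G))"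

section \<open>Adjacency-list access\<close>

record graph_access =
  deg_in :: "nat \<Rightarrow> nat"
  deg_out :: "nat \<Rightarrow> nat"
  in_nbr :: "nat \<Rightarrow> nat \<Rightarrow> nat"
  out_nbr :: "nat \<Rightarrow> nat \<Rightarrow> nat"
  in_sorted :: "nat \<Rightarrow> nat \<Rightarrow> nat"

text \<open>Neighbours are numbered from 1, in an arbitrary order for \<open>in_nbr\<close> and \<open>out_nbr\<close> and by
  ascending out-degree (ties broken arbitrarily) for \<open>in_sorted\<close>. Answers to queries with an
  index out of range are unspecified. A number that is not a vertex has both degrees 0.

  Vertices are arbitrary natural numbers rather than an initial segment: they serve as opaque
  names, so that knowing \<open>n\<close> does not give an algorithm a way to enumerate or sample them.\<close>

definition adjacency_access :: "nat pair_pre_digraph \<Rightarrow> graph_access \<Rightarrow> bool" where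
  "adjacency_access G Q \<longleftrightarrow>
     (\<forall>u. deg_in Q u = in_degree G u \<and>
          deg_out Q u = out_degree G u \<and>
          bij_betw (in_nbr Q u) {1..in_degree G u} {v. v \<rightarrow>\<^bsub>G\<^esub> u} \<and>
          bij_betw (out_nbr Q u) {1..out_degree G u} {v. u \<rightarrow>\<^bsub>G\<^esub> v} \<and>
          bij_betw (in_sorted Q u) {1..in_degree G u} {v. v \<rightarrow>\<^bsub>G\<^esub> u} \<and>
          mono_on {1..in_degree G u} (\<lambda>i. out_degree G (in_sorted Q u i)))"

section \<open>A randomized real RAM with graph queries\<close>

text \<open>The machine has an integer memory and a real memory, both addressed (also indirectly) by
  integers. Integers support addition, truncated subtraction and comparison; reals support the
  field operations and comparison. Integers can be converted to reals, but there is no rounding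
  of reals to integers. The only literals are natural numbers, so a program cannot hide
  information in real constants.

  The graph is accessible only through the query expressions.\<close>

datatype nexp =
    NConst nat
  | NLoad nexp
  | NAdd nexp nexp
  | NSub nexp nexp
  | DegIn nexp
  | DegOut nexp
  | InNbr nexp nexp
  | OutNbr nexp nexp
  | InSorted nexp nexp

datatype rexp =
    OfNat nexp
  | RLoad nexp
  | RAdd rexp rexp
  | RSub rexp rexp
  | RMul rexp rexp
  | RDiv rexp rexp

datatype bexp =
    NLess nexp nexp
  | RLess rexp rexp
  | BNot bexp
  | BAnd bexp bexp

text \<open>\<open>Flip a p\<close> stores 1 at integer address \<open>a\<close> with probability \<open>p\<close> and 0 otherwise, where
  \<open>p\<close> is first clamped to the unit interval.\<close>

datatype com =
    Skip
  | NStore nexp nexp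
  | RStore nexp rexp
  | Flip nexp rexp
  | Seq com com
  | Cond bexp com com
  | While bexp com

record memory =
  nmem :: "nat \<Rightarrow> nat"
  rmem :: "nat \<Rightarrow> real"

primrec nval :: "graph_access \<Rightarrow> memory \<Rightarrow> nexp \<Rightarrow> nat" where
  "nval Q m (NConst k) = k"
| "nval Q m (NLoad a) = nmem m (nval Q m a)"
| "nval Q m (NAdd a b) = nval Q m a + nval Q m b"
| "nval Q m (NSub a b) = nval Q m a - nval Q m b"
| "nval Q m (DegIn u) = deg_in Q (nval Q m u)"
| "nval Q m (DegOut u) = deg_out Q (nval Q m u)"
| "nval Q m (InNbr u i) = in_nbr Q (nval Q m u) (nval Q m i)"
| "nval Q m (OutNbr u i) = out_nbr Q (nval Q m u) (nval Q m i)"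
| "nval Q m (InSorted u i) = in_sorted Q (nval Q m u) (nval Q m i)"

primrec rval :: "graph_access \<Rightarrow> memory \<Rightarrow> rexp \<Rightarrow> real" where
  "rval Q m (OfNat a) = real (nval Q m a)"
| "rval Q m (RLoad a) = rmem m (nval Q m a)"
| "rval Q m (RAdd x y) = rval Q m x + rval Q m y"
| "rval Q m (RSub x y) = rval Q m x - rval Q m y"
| "rval Q m (RMul x y) = rval Q m x * rval Q m y"
| "rval Q m (RDiv x y) = rval Q m x / rval Q m y"

primrec bval :: "graph_access \<Rightarrow> memory \<Rightarrow> bexp \<Rightarrow> bool" where
  "bval Q m (NLess a b) \<longleftrightarrow> nval Q m a < nval Q m b"
| "bval Q m (RLess x y) \<longleftrightarrow> rval Q m x < rval Q m y"
| "bval Q m (BNot b) \<longleftrightarrow> \<not> bval Q m b"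
| "bval Q m (BAnd b c) \<longleftrightarrow> bval Q m b \<and> bval Q m c"

text \<open>One step evaluates a bounded number of expressions of the program. As the program is fixed,
  these have constant size, so a step is a constant number of machine operations and queries.\<close>

primrec com_step :: "graph_access \<Rightarrow> com \<Rightarrow> memory \<Rightarrow> (com \<times> memory) pmf" where
  "com_step Q Skip m = return_pmf (Skip, m)"
| "com_step Q (NStore a e) m =
     return_pmf (Skip, m\<lparr>nmem := (nmem m)(nval Q m a := nval Q m e)\<rparr>)"
| "com_step Q (RStore a e) m =
     return_pmf (Skip, m\<lparr>rmem := (rmem m)(nval Q m a := rval Q m e)\<rparr>)"
| "com_step Q (Flip a p) m =
     map_pmf (\<lambda>b. (Skip, m\<lparr>nmem := (nmem m)(nval Q m a := of_bool b)\<rparr>))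
       (bernoulli_pmf (rval Q m p))"
| "com_step Q (Seq c d) m =
     (if c = Skip then return_pmf (d, m)
      else map_pmf (\<lambda>(c', m'). (Seq c' d, m')) (com_step Q c m))"
| "com_step Q (Cond b c d) m = return_pmf (if bval Q m b then c else d, m)"
| "com_step Q (While b c) m =
     return_pmf (if bval Q m b then Seq c (While b c) else Skip, m)"

definition run :: "graph_access \<Rightarrow> com \<Rightarrow> memory \<Rightarrow> nat \<Rightarrow> (com \<times> memory) pmf" where
  "run Q c m k = chain (\<lambda>(c, m). com_step Q c m) k (c, m)"

text \<open>A configuration is halted iff its command is \<open>Skip\<close>. The expectation of the number \<open>T\<close> of
  steps before halting is the sum over \<open>k\<close> of the probabilities of \<open>T > k\<close>; it is infinite if
  the program fails to halt with positive probability.\<close>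

definition expected_time :: "graph_access \<Rightarrow> com \<Rightarrow> memory \<Rightarrow> ennreal" where
  "expected_time Q c m = (\<Sum>k. emeasure (measure_pmf (run Q c m k)) {(c', m'). c' \<noteq> Skip})"

text \<open>The probability of halting with an output in \<open>A\<close>, the output being real cell 0.\<close>

definition output_prob :: "graph_access \<Rightarrow> com \<Rightarrow> memory \<Rightarrow> real set \<Rightarrow> real" where
  "output_prob Q c m A =
     (SUP k. measure_pmf.prob (run Q c m k) {(c', m'). c' = Skip \<and> rmem m' 0 \<in> A})"

definition input :: "nat \<Rightarrow> nat \<Rightarrow> real \<Rightarrow> real \<Rightarrow> real \<Rightarrow> memory" where
  "input n t \<alpha> \<epsilon> p\<^sub>f =
     \<lparr>nmem = (\<lambda>_. 0)(0 := n, 1 := t), rmem = (\<lambda>_. 0)(0 := \<alpha>, 1 := \<epsilon>, 2 := p\<^sub>f)\<rparr>"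

definition soft_O :: "(nat \<Rightarrow> real) \<Rightarrow> (nat \<Rightarrow> real) set" where
  "soft_O f = {T. \<exists>k::nat. T \<in> O(\<lambda>n. f n * ln (real n) ^ k)}"

end

theory Submission
  imports Defs
begin

text \<open>
  A trial is a branching process that starts with a single particle at \<open>t\<close>. In each round the process
  stops with probability \<open>\<beta>\<close>; otherwise every particle at \<open>v\<close> is replaced by particles at in-neighbours
  of \<open>v\<close>, where an in-neighbour \<open>u\<close> is chosen with probability \<open>x / d(u)\<close> and \<open>(1 - \<beta>) * x = 1 - \<alpha>\<close>.
  The expected number of particles at \<open>u\<close> when the process stops is then a fixed multiple of
  \<open>\<pi>(u, t)\<close>, so the mean \<open>\<mu>\<close> of the final population \<open>X\<close> is a fixed multiple of \<open>n * \<pi>(t)\<close>. Since the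
  in-neighbours come sorted by out-degree, the chosen ones can be taken to be a prefix of the list, and
  a trial costs time proportional to the number of its particles, which is \<open>O(\<mu>)\<close> in expectation.

  Different particles act independently, and those at \<open>u\<close> average over the out-neighbours of \<open>u\<close>;
  by induction on the rounds, the second moment of their number is at most \<open>1 / (1 - x)\<close> times its
  mean, whatever the correlation between different \<open>u\<close>. The Cauchy-Schwarz inequality over the \<open>n\<close>
  sources gives \<open>E X\<^sup>2 \<le> n * \<mu> / (1 - x)\<close>. Hence trials are repeated until their total size exceeds
  \<open>K * n\<close> for a large constant \<open>K\<close>: this takes about \<open>K * n / \<mu>\<close> trials and \<open>O(n)\<close> time, and by
  Kolmogorov's inequality the number of trials determines \<open>\<mu>\<close> up to a small relative error.
\<close>

section \<open>Expected cost of programs\<close>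

text \<open>The expected number of steps, weighted by \<open>\<tau>\<close>, plus the expected value of \<open>f\<close> in the final
  memory. With \<open>\<tau> = 1\<close>, \<open>f = 0\<close> this is the expected time, with \<open>\<tau> = 0\<close> an output probability.\<close>

primrec ert :: "graph_access \<Rightarrow> ennreal \<Rightarrow> com \<Rightarrow> (memory \<Rightarrow> ennreal) \<Rightarrow> memory \<Rightarrow> ennreal" where
  "ert Q \<tau> Skip f m = f m"
| "ert Q \<tau> (NStore a e) f m = \<tau> + f (m\<lparr>nmem := (nmem m)(nval Q m a := nval Q m e)\<rparr>)"
| "ert Q \<tau> (RStore a e) f m = \<tau> + f (m\<lparr>rmem := (rmem m)(nval Q m a := rval Q m e)\<rparr>)"
| "ert Q \<tau> (Flip a p) f m =
     \<tau> + (\<integral>\<^sup>+ b. f (m\<lparr>nmem := (nmem m)(nval Q m a := of_bool b)\<rparr>) \<partial>bernoulli_pmf (rval Q m p))"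
| "ert Q \<tau> (Seq c d) f m = ert Q \<tau> c (\<lambda>m. \<tau> + ert Q \<tau> d f m) m"
| "ert Q \<tau> (Cond b c d) f m = \<tau> + (if bval Q m b then ert Q \<tau> c f m else ert Q \<tau> d f m)"
| "ert Q \<tau> (While b c) f m =
     lfp (\<lambda>W m. \<tau> + (if bval Q m b then ert Q \<tau> c (\<lambda>m. \<tau> + W m) m else f m)) m"

lemma ert_mono: "(\<And>m. f m \<le> g m) \<Longrightarrow> ert Q \<tau> c f m \<le> ert Q \<tau> c g m"
proof (induction c arbitrary: f g m)
  case (Flip a p)
  then show ?case by (auto intro!: add_left_mono nn_integral_mono)
next
  case (Seq c d)
  show ?case by (auto intro!: Seq.IH(1) add_left_mono Seq.IH(2) Seq.prems)
next
  case (While b c)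
  show ?case
    unfolding ert.simps
    by (rule le_funD, rule lfp_mono, rule le_funI) (use While.prems in \<open>auto intro: add_left_mono\<close>)
qed (auto intro: add_left_mono)

lemma ert_While_unfold:
  "ert Q \<tau> (While b c) f m =
     \<tau> + (if bval Q m b then ert Q \<tau> c (\<lambda>m. \<tau> + ert Q \<tau> (While b c) f m) m else f m)"
proof -
  have "mono (\<lambda>W m. \<tau> + (if bval Q m b then ert Q \<tau> c (\<lambda>m. \<tau> + W m) m else f m))"
    by (rule monoI, rule le_funI) (auto intro!: add_left_mono ert_mono dest: le_funD)
  from lfp_unfold[OF this] show ?thesis
    by (simp add: fun_eq_iff)
qed

text \<open>A least fixed point lies below every pre-fixed point, so a loop is bounded by a one-step
  inequality for a candidate \<open>I\<close>, with no termination argument.\<close>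

lemma ert_While_le:
  assumes "\<And>m. \<tau> + (if bval Q m b then ert Q \<tau> c (\<lambda>m. \<tau> + I m) m else f m) \<le> I m"
  shows "ert Q \<tau> (While b c) f m \<le> I m"
  unfolding ert.simps by (rule le_funD, rule lfp_lowerbound, rule le_funI) (rule assms)

declare ert.simps(7) [simp del]

text \<open>This ties \<open>ert\<close> to the small-step semantics. A finished first half
  \<open>Seq Skip d\<close> takes one step to become \<open>d\<close>; this is the extra
  \<open>\<tau>\<close> between the two halves in the equations for \<open>Seq\<close> and
  \<open>While\<close>.\<close>

lemma ert_step:
  "c \<noteq> Skip \<Longrightarrow>
   ert Q \<tau> c f m = \<tau> + (\<integral>\<^sup>+ (c', m'). ert Q \<tau> c' f m' \<partial>com_step Q c m)"
proof (induction c arbitrary: f m)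
  case (Seq c d)
  show ?case
    by (cases "c = Skip") (auto simp: Seq.IH(1) case_prod_unfold)
next
  case (While b c)
  show ?case
    by (subst ert_While_unfold) auto
qed (auto simp: case_prod_unfold)

text \<open>Each step trades \<open>\<tau>\<close> for every configuration that has not halted
  against an equal drop of the expected remaining \<open>ert\<close>; the induction sums these
  trades.\<close>

lemma ert_run_le:
  "(\<integral>\<^sup>+ (c', m'). ert Q \<tau> c' f m' \<partial>run Q c m k) +
     \<tau> * (\<Sum>i<k. emeasure (run Q c m i) {(c', m'). c' \<noteq> Skip}) \<le> ert Q \<tau> c f m"
proof (induction k)
  case 0
  then show ?case by (simp add: run_def)
next
  case (Suc k)
  let ?E = "\<lambda>(c, m). ert Q \<tau> c f m" and ?N = "{(c', m' :: memory). c' \<noteq> Skip}"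
  have "(\<integral>\<^sup>+ x. ?E x \<partial>run Q c m (Suc k)) + \<tau> * emeasure (run Q c m k) ?N =
      (\<integral>\<^sup>+ x. (\<integral>\<^sup>+ y. ?E y \<partial>(case x of (c, m) \<Rightarrow> com_step Q c m)) + \<tau> * indicator ?N x \<partial>run Q c m k)"
    by (simp add: run_def nn_integral_add nn_integral_cmult)
  also have "\<dots> = (\<integral>\<^sup>+ x. ?E x \<partial>run Q c m k)"
  proof (rule nn_integral_cong)
    fix x :: "com \<times> memory"
    obtain c m where x: "x = (c, m)" by (cases x)
    show "(\<integral>\<^sup>+ y. ?E y \<partial>(case x of (c, m) \<Rightarrow> com_step Q c m)) + \<tau> * indicator ?N x = ?E x"
      by (cases "c = Skip") (simp_all add: x ert_step[of c] add.commute)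
  qed
  finally have "(\<integral>\<^sup>+ x. ?E x \<partial>run Q c m (Suc k)) + \<tau> * emeasure (run Q c m k) ?N =
    (\<integral>\<^sup>+ x. ?E x \<partial>run Q c m k)" .
  moreover have "(\<integral>\<^sup>+ x. ?E x \<partial>run Q c m (Suc k)) +
      \<tau> * (\<Sum>i<Suc k. emeasure (run Q c m i) ?N) =
    ((\<integral>\<^sup>+ x. ?E x \<partial>run Q c m (Suc k)) + \<tau> * emeasure (run Q c m k) ?N) +
      \<tau> * (\<Sum>i<k. emeasure (run Q c m i) ?N)"
    by (simp only: sum.lessThan_Suc distrib_left add_ac)
  ultimately show ?case
    using Suc.IH by (simp only:)
qed

lemma expected_time_le_ert: "expected_time Q c m \<le> ert Q 1 c (\<lambda>_. 0) m"
proof -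
  have "(\<Sum>i<k. emeasure (run Q c m i) {(c', m'). c' \<noteq> Skip}) \<le> ert Q 1 c (\<lambda>_. 0) m" for k
    using ert_run_le[of Q c m k 1 "\<lambda>_. 0"] by (auto intro: order_trans[rotated])
  then show ?thesis
    unfolding expected_time_def suminf_eq_SUP by (rule SUP_least)
qed

lemma output_prob_le_ert:
  assumes "ert Q 0 c (\<lambda>m. indicator A (rmem m 0)) m \<le> ennreal p" "0 \<le> p"
  shows "output_prob Q c m A \<le> p"
  unfolding output_prob_def
proof (rule cSUP_least)
  fix k
  let ?B = "{(c', m'). c' = Skip \<and> rmem m' 0 \<in> A}"
  have "emeasure (run Q c m k) ?B = (\<integral>\<^sup>+ x. indicator ?B x \<partial>run Q c m k)"
    by simp
  also have "\<dots> \<le> (\<integral>\<^sup>+ (c', m'). ert Q 0 c' (\<lambda>m. indicator A (rmem m 0)) m' \<partial>run Q c m k)"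
    by (rule nn_integral_mono) (auto simp: indicator_def)
  also have "\<dots> \<le> ennreal p"
    using ert_run_le[of Q c m k 0 "\<lambda>m. indicator A (rmem m 0)"] assms(1) by simp
  finally show "measure_pmf.prob (run Q c m k) ?B \<le> p"
    using assms(2) by (simp add: measure_pmf.emeasure_eq_measure)
qed simp

section \<open>The branching process\<close>

text \<open>Having reached \<open>w\<close>, the prefix is extended to the next element \<open>u\<close> with probability \<open>d w / d u\<close>.
  The product telescopes, so that each element is reached with probability \<open>x\<close> over its degree.\<close>

primrec prefix_pmf :: "(nat \<Rightarrow> nat) \<Rightarrow> real \<Rightarrow> nat list \<Rightarrow> nat list pmf" where
  "prefix_pmf d x [] = return_pmf []"
| "prefix_pmf d x (u # us) =
     bind_pmf (bernoulli_pmf (x / real (d u)))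
       (\<lambda>b. if b then map_pmf ((#) u) (prefix_pmf d (real (d u)) us) else return_pmf [])"

definition in_list :: "graph_access \<Rightarrow> nat \<Rightarrow> nat list" where
  "in_list Q v = map (in_sorted Q v) [1..<Suc (deg_in Q v)]"

primrec generation :: "graph_access \<Rightarrow> real \<Rightarrow> nat list \<Rightarrow> nat list pmf" where
  "generation Q x [] = return_pmf []"
| "generation Q x (v # vs) =
     bind_pmf (prefix_pmf (deg_out Q) x (in_list Q v)) (\<lambda>ys. map_pmf ((@) ys) (generation Q x vs))"

text \<open>All particles share one geometric clock. Drawing it in advance makes the moments easy;
  \<open>trial_unfold\<close> recovers the coin-by-coin form that the program executes.\<close>

definition trial :: "graph_access \<Rightarrow> real \<Rightarrow> real \<Rightarrow> nat list \<Rightarrow> nat list pmf" where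
  "trial Q x \<beta> xs = bind_pmf (geometric_pmf \<beta>) (\<lambda>l. chain (generation Q x) l xs)"

lemma chain_Suc_first: "chain K (Suc k) s = bind_pmf (K s) (chain K k)"
  by (induction k) (simp_all add: bind_return_pmf bind_return_pmf' bind_assoc_pmf)

section \<open>Moments of a random prefix\<close>

lemma nn_integral_count_prefix_pmf:
  assumes "distinct us" "sorted (map d us)" "0 \<le> x" "\<forall>w\<in>set us. 0 < d w \<and> x \<le> real (d w)"
  shows "(\<integral>\<^sup>+ ys. ennreal (real (count_list ys u)) \<partial>prefix_pmf d x us) =
    ennreal (if u \<in> set us then x / real (d u) else 0)"
  using assms
proof (induction us arbitrary: x)
  case Nil
  then show ?case by simp
next
  case (Cons w us)
  have p: "0 \<le> x / real (d w)" "x / real (d w) \<le> 1" "0 < d w"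
    using Cons.prems by (auto simp: divide_simps)
  have IH: "(\<integral>\<^sup>+ ys. ennreal (real (count_list ys u)) \<partial>prefix_pmf d (real (d w)) us) =
      ennreal (if u \<in> set us then real (d w) / real (d u) else 0)"
    by (rule Cons.IH) (use Cons.prems in auto)
  have "(\<integral>\<^sup>+ ys. ennreal (real (count_list ys u)) \<partial>prefix_pmf d x (w # us)) =
      ennreal (x / real (d w)) * (\<integral>\<^sup>+ ys. ennreal (real (count_list (w # ys) u)) \<partial>prefix_pmf d (real (d w)) us)"
    using p by (simp add: mult.commute)
  also have "(\<integral>\<^sup>+ ys. ennreal (real (count_list (w # ys) u)) \<partial>prefix_pmf d (real (d w)) us) =
      (\<integral>\<^sup>+ ys. ennreal (of_bool (w = u)) + ennreal (real (count_list ys u)) \<partial>prefix_pmf d (real (d w)) us)"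
    by (intro nn_integral_cong) (auto simp flip: ennreal_plus)
  also have "\<dots> = ennreal (of_bool (w = u) + (if u \<in> set us then real (d w) / real (d u) else 0))"
    by (simp add: nn_integral_add IH)
  also have "ennreal (x / real (d w)) * \<dots> = ennreal (if u \<in> set (w # us) then x / real (d u) else 0)"
    using Cons.prems p by (auto simp flip: ennreal_mult')
  finally show ?case .
qed

lemma set_prefix_pmf: "ys \<in> set_pmf (prefix_pmf d x us) \<Longrightarrow> \<exists>zs. us = ys @ zs"
  by (induction us arbitrary: x ys) (auto split: if_splits)

text \<open>A prefix of a duplicate-free list is duplicate-free, so each count is 0 or 1 and equals
  its square.\<close>

lemma nn_integral_count_sq_prefix_pmf:
  assumes "distinct us"
  shows "(\<integral>\<^sup>+ ys. ennreal ((real (count_list ys u))\<^sup>2) \<partial>prefix_pmf d x us) =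
    (\<integral>\<^sup>+ ys. ennreal (real (count_list ys u)) \<partial>prefix_pmf d x us)"
proof (rule nn_integral_cong_AE, unfold AE_measure_pmf_iff, intro ballI)
  fix ys assume "ys \<in> set_pmf (prefix_pmf d x us)"
  then have "distinct ys"
    using set_prefix_pmf assms by fastforce
  then have "count_list ys u = (if u \<in> set ys then 1 else 0)"
    by (induction ys) auto
  then show "ennreal ((real (count_list ys u))\<^sup>2) = ennreal (real (count_list ys u))"
    by simp
qed

section \<open>The graph and its sorted lists of in-neighbours\<close>

locale graph_queries =
  fixes G :: "nat pair_pre_digraph" and Q :: graph_access and t :: nat
  assumes fin: "pair_fin_digraph G" and access: "adjacency_access G Q" and target: "t \<in> pverts G"
begin

abbreviation d :: "nat \<Rightarrow> nat" where "d \<equiv> deg_out Q"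
abbreviation out :: "nat \<Rightarrow> nat set" where "out u \<equiv> {v. u \<rightarrow>\<^bsub>G\<^esub> v}"
abbreviation n :: nat where "n \<equiv> card (pverts G)"

lemma finite_verts: "finite (pverts G)"
  using fin by (rule pair_fin_digraph.pair_finite_verts)

lemma bij_out: "bij_betw (out_nbr Q u) {1..d u} (out u)"
  and bij_in: "bij_betw (in_sorted Q v) {1..deg_in Q v} {u. u \<rightarrow>\<^bsub>G\<^esub> v}"
  and mono_in: "mono_on {1..deg_in Q v} (\<lambda>i. d (in_sorted Q v i))"
  using access by (simp_all add: adjacency_access_def)

lemma card_out: "card (out u) = d u" and finite_out: "finite (out u)"
  using bij_betw_same_card[OF bij_out] bij_betw_finite[OF bij_out] by simp_all

lemma edge_verts: "u \<rightarrow>\<^bsub>G\<^esub> v \<Longrightarrow> u \<in> pverts G \<and> v \<in> pverts G"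
proof -
  interpret pair_fin_digraph G by (rule fin)
  show "u \<rightarrow>\<^bsub>G\<^esub> v \<Longrightarrow> u \<in> pverts G \<and> v \<in> pverts G"
    by (auto dest: adj_in_verts)
qed

lemma set_in_list: "set (in_list Q v) = {u. u \<rightarrow>\<^bsub>G\<^esub> v}"
  using bij_betw_imp_surj_on[OF bij_in, of v] by (simp add: in_list_def atLeastLessThanSuc_atLeastAtMost del: upt_Suc)

lemma distinct_in_list: "distinct (in_list Q v)"
  using bij_betw_imp_inj_on[OF bij_in, of v]
  by (simp add: in_list_def distinct_map atLeastLessThanSuc_atLeastAtMost del: upt_Suc)

lemma sorted_in_list: "sorted (map d (in_list Q v))"
  unfolding sorted_iff_nth_mono
proof (intro allI impI)
  fix i j assume "i \<le> j" "j < length (map d (in_list Q v))"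
  then show "map d (in_list Q v) ! i \<le> map d (in_list Q v) ! j"
    using mono_onD[OF mono_in[of v], of "Suc i" "Suc j"] by (simp add: in_list_def del: upt_Suc)
qed

lemma edge_deg_pos: "u \<rightarrow>\<^bsub>G\<^esub> v \<Longrightarrow> 0 < d u"
  using card_out[of u] finite_out[of u] by (metis card_gt_0_iff empty_iff mem_Collect_eq)

text \<open>This is \<open>x ^ l\<close> times the probability that a walk from \<open>u\<close>
  that never stops voluntarily is at \<open>t\<close> after \<open>l\<close> moves. At a node
  without out-neighbours the positive levels are 0, since no move is possible.\<close>

primrec level :: "real \<Rightarrow> nat \<Rightarrow> nat \<Rightarrow> real" where
  "level x 0 u = of_bool (u = t)"
| "level x (Suc l) u = x / real (d u) * (\<Sum>v\<in>out u. level x l v)"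

section \<open>Moments of the population at a node, round by round\<close>

context
  fixes x :: real
  assumes x: "0 < x" "x < 1"
begin

definition spawn_prob :: "nat \<Rightarrow> nat \<Rightarrow> real" where
  "spawn_prob u v = (if u \<rightarrow>\<^bsub>G\<^esub> v then x / real (d u) else 0)"

lemma spawn_prob_nonneg: "0 \<le> spawn_prob u v"
  using x by (simp add: spawn_prob_def)

lemma nn_integral_count_spawn:
  "(\<integral>\<^sup>+ ys. ennreal (real (count_list ys u)) \<partial>prefix_pmf d x (in_list Q v)) = ennreal (spawn_prob u v)"
proof -
  have "x \<le> real (d w)" if "w \<rightarrow>\<^bsub>G\<^esub> v" for w
    using x edge_deg_pos[OF that] by linarith
  then show ?thesis
    using x by (subst nn_integral_count_prefix_pmf)
      (auto simp: distinct_in_list sorted_in_list set_in_list spawn_prob_def edge_deg_pos)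
qed

lemma nn_integral_count_generation:
  "(\<integral>\<^sup>+ ys. ennreal (real (count_list ys u)) \<partial>generation Q x xs) = ennreal (\<Sum>v\<leftarrow>xs. spawn_prob u v)"
proof (induction xs)
  case (Cons v xs)
  have "0 \<le> (\<Sum>v\<leftarrow>xs. spawn_prob u v)"
    by (auto intro!: sum_list_nonneg spawn_prob_nonneg)
  then show ?case
    by (simp add: nn_integral_add nn_integral_count_spawn spawn_prob_nonneg Cons)
qed simp

text \<open>For fixed \<open>u\<close>, different particles contribute independent 0/1 variables,
  and the variance of such a sum is at most its mean.\<close>

lemma nn_integral_count_sq_generation:
  "(\<integral>\<^sup>+ ys. ennreal ((real (count_list ys u))\<^sup>2) \<partial>generation Q x xs) \<le>
     ennreal ((\<Sum>v\<leftarrow>xs. spawn_prob u v)\<^sup>2 + (\<Sum>v\<leftarrow>xs. spawn_prob u v))"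
proof (induction xs)
  case (Cons v xs)
  let ?M = "\<Sum>v\<leftarrow>xs. spawn_prob u v" and ?c = "\<lambda>ys. real (count_list ys u)"
  let ?P = "prefix_pmf d x (in_list Q v)" and ?G = "generation Q x xs"
  have M: "0 \<le> ?M" "0 \<le> spawn_prob u v"
    by (auto intro!: sum_list_nonneg spawn_prob_nonneg)
  have "(\<integral>\<^sup>+ ys. ennreal ((?c ys)\<^sup>2) \<partial>generation Q x (v # xs)) =
      (\<integral>\<^sup>+ ys. \<integral>\<^sup>+ zs. ennreal ((?c ys)\<^sup>2) + ennreal (2 * ?c ys) * ennreal (?c zs) + ennreal ((?c zs)\<^sup>2) \<partial>?G \<partial>?P)"
    by (simp add: power2_sum flip: ennreal_plus ennreal_mult')
       (simp add: add_ac)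
  also have "\<dots> = (\<integral>\<^sup>+ ys. ennreal ((?c ys)\<^sup>2) + ennreal (?c ys) * ennreal (2 * ?M) +
      (\<integral>\<^sup>+ zs. ennreal ((?c zs)\<^sup>2) \<partial>?G) \<partial>?P)"
    using M by (intro nn_integral_cong)
      (simp add: nn_integral_add nn_integral_cmult nn_integral_count_generation ennreal_mult ac_simps)
  also have "\<dots> = ennreal (spawn_prob u v) + ennreal (spawn_prob u v) * ennreal (2 * ?M) +
      (\<integral>\<^sup>+ zs. ennreal ((?c zs)\<^sup>2) \<partial>?G)"
    by (simp add: nn_integral_add nn_integral_multc nn_integral_count_sq_prefix_pmf distinct_in_list
        nn_integral_count_spawn)
  also have "\<dots> \<le> ennreal (spawn_prob u v) + ennreal (spawn_prob u v) * ennreal (2 * ?M) + ennreal (?M\<^sup>2 + ?M)"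
    by (intro add_left_mono Cons.IH)
  also have "\<dots> \<le> ennreal ((\<Sum>v\<leftarrow>v # xs. spawn_prob u v)\<^sup>2 + (\<Sum>v\<leftarrow>v # xs. spawn_prob u v))"
    using M by (simp flip: ennreal_plus ennreal_mult')
      (simp add: power2_sum)
  finally show ?case .
qed simp

text \<open>Grouping the particles by position turns the conditional mean at \<open>u\<close> into
  \<open>x\<close> times the average count over the out-neighbours of \<open>u\<close>.\<close>

lemma sum_list_spawn_prob:
  "(\<Sum>v\<leftarrow>xs. spawn_prob u v) = x / real (d u) * (\<Sum>v\<in>out u. real (count_list xs v))"
proof (induction xs)
  case (Cons w xs)
  have "(\<Sum>v\<in>out u. real (count_list (w # xs) v)) =
      (\<Sum>v\<in>out u. of_bool (v = w) + real (count_list xs v))"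
    by (intro sum.cong) auto
  also have "\<dots> = of_bool (w \<in> out u) + (\<Sum>v\<in>out u. real (count_list xs v))"
    using finite_out[of u] by (auto simp: sum.distrib of_bool_def)
  finally show ?case
    using Cons by (simp add: spawn_prob_def algebra_simps)
qed simp

lemma level_nonneg: "0 \<le> level x l u"
  using x by (induction l arbitrary: u) (auto intro!: mult_nonneg_nonneg divide_nonneg_nonneg sum_nonneg)

text \<open>The last round of the backward process is the first move of the forward walk, so both
  satisfy the same recursion.\<close>

lemma nn_integral_count_chain:
  "(\<integral>\<^sup>+ ys. ennreal (real (count_list ys u)) \<partial>chain (generation Q x) l [t]) = ennreal (level x l u)"
proof (induction l arbitrary: u)
  case (Suc l)
  have "(\<integral>\<^sup>+ ys. ennreal (real (count_list ys u)) \<partial>chain (generation Q x) (Suc l) [t]) =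
    (\<integral>\<^sup>+ xs. ennreal (x / real (d u)) * (\<Sum>v\<in>out u. ennreal (real (count_list xs v))) \<partial>chain (generation Q x) l [t])"
    using x by (simp add: nn_integral_count_generation sum_list_spawn_prob sum_nonneg flip: ennreal_mult')
  also have "\<dots> = ennreal (x / real (d u)) * (\<Sum>v\<in>out u. ennreal (level x l v))"
    by (simp add: nn_integral_cmult nn_integral_sum Suc.IH del: sum_ennreal)
  finally show ?case
    using x by (simp add: level_nonneg sum_nonneg flip: ennreal_mult')
qed auto

text \<open>Given the previous round, the second moment is at most the squared conditional mean plus
  the conditional mean. Averaging the squares leaves a spare factor \<open>x\<close> in front of the
  inductive bound, and \<open>B = 1 / (1 - x)\<close> solves \<open>x * B + 1 = B\<close>.\<close>

lemma nn_integral_count_sq_chain: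
  "(\<integral>\<^sup>+ ys. ennreal ((real (count_list ys u))\<^sup>2) \<partial>chain (generation Q x) l [t]) \<le> ennreal (level x l u / (1 - x))"
proof (induction l arbitrary: u)
  case 0
  show ?case
    using x by (auto simp: divide_simps)
next
  case (Suc l)
  let ?c = "\<lambda>xs v. real (count_list xs v)"
  \<comment> \<open>Cauchy-Schwarz over the out-neighbours allows their counts to be correlated in
    any way. For \<open>d u = 0\<close> both sides are 0 by division by zero.\<close>
  have J: "(x / real (d u) * (\<Sum>v\<in>out u. ?c xs v))\<^sup>2 \<le> x\<^sup>2 / real (d u) * (\<Sum>v\<in>out u. (?c xs v)\<^sup>2)" for xs
  proof (cases "d u = 0")
    case False
    have "(\<Sum>v\<in>out u. ?c xs v)\<^sup>2 \<le> real (d u) * (\<Sum>v\<in>out u. (?c xs v)\<^sup>2)"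
      using sum_squared_le_sum_of_squares[of "?c xs" "out u"] unfolding card_out by (simp only: mult.commute)
    then have "x\<^sup>2 * (\<Sum>v\<in>out u. ?c xs v)\<^sup>2 \<le> x\<^sup>2 * (real (d u) * (\<Sum>v\<in>out u. (?c xs v)\<^sup>2))"
      by (rule mult_left_mono) simp
    then show ?thesis
      using False by (simp add: field_simps power2_eq_square)
  qed simp
  have "(\<integral>\<^sup>+ ys. ennreal ((?c ys u)\<^sup>2) \<partial>chain (generation Q x) (Suc l) [t]) \<le>
    (\<integral>\<^sup>+ xs. ennreal ((x / real (d u) * (\<Sum>v\<in>out u. ?c xs v))\<^sup>2 + x / real (d u) * (\<Sum>v\<in>out u. ?c xs v))
      \<partial>chain (generation Q x) l [t])"
    using nn_integral_count_sq_generation by (auto simp: sum_list_spawn_prob intro!: nn_integral_mono)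
  also have "\<dots> \<le> (\<integral>\<^sup>+ xs. ennreal (x\<^sup>2 / real (d u)) * (\<Sum>v\<in>out u. ennreal ((?c xs v)\<^sup>2)) +
       ennreal (x / real (d u)) * (\<Sum>v\<in>out u. ennreal (?c xs v)) \<partial>chain (generation Q x) l [t])"
    using x J by (intro nn_integral_mono)
      (simp add: sum_nonneg ennreal_leI flip: ennreal_mult' ennreal_plus)
  also have "\<dots> = ennreal (x\<^sup>2 / real (d u)) *
        (\<Sum>v\<in>out u. \<integral>\<^sup>+ xs. ennreal ((?c xs v)\<^sup>2) \<partial>chain (generation Q x) l [t]) +
       ennreal (x / real (d u)) * (\<Sum>v\<in>out u. ennreal (level x l v))"
    by (simp add: nn_integral_add nn_integral_cmult nn_integral_sum nn_integral_count_chain del: sum_ennreal)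
  also have "\<dots> \<le> ennreal (x\<^sup>2 / real (d u)) * (\<Sum>v\<in>out u. ennreal (level x l v / (1 - x))) +
       ennreal (x / real (d u)) * (\<Sum>v\<in>out u. ennreal (level x l v))"
    by (intro add_right_mono mult_left_mono sum_mono Suc.IH) simp
  also have "\<dots> = ennreal (x * (level x (Suc l) u / (1 - x)) + level x (Suc l) u)"
    using x by (simp add: level_nonneg sum_nonneg power2_eq_square flip: sum_divide_distrib ennreal_mult' ennreal_plus)
  also have "x * (level x (Suc l) u / (1 - x)) + level x (Suc l) u = level x (Suc l) u / (1 - x)"
    using x by (simp add: field_simps del: level.simps)
  finally show ?case .
qed

end
end

section \<open>Trials and PageRank\<close>

lemma chain_Stopped: "chain (walk_step \<alpha> G) k (Stopped u) = return_pmf (Stopped u)"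
  by (induction k) (simp_all add: bind_return_pmf)

lemma nn_integral_geometric_pmf:
  assumes "0 < p" "p \<le> 1"
  shows "(\<integral>\<^sup>+ l. f l \<partial>geometric_pmf p) = ennreal p * (\<Sum>l. ennreal ((1 - p) ^ l) * f l)"
  using assms
  by (simp add: nn_integral_measure_pmf nn_integral_count_space_nat pmf_geometric ennreal_mult mult_ac
      flip: ennreal_suminf_cmult)

lemma length_eq_sum_count:
  assumes "finite A" "set xs \<subseteq> A"
  shows "real (length xs) = (\<Sum>u\<in>A. real (count_list xs u))"
  using sum_count_set[OF assms(2,1)] by (simp flip: of_nat_sum)

context graph_queries begin

section \<open>PageRank as a series of levels\<close>

lemma level_scale: "level (c * x) l u = c ^ l * level x l u"
  by (induction l arbitrary: u) (simp_all add: sum_distrib_left mult_ac)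

text \<open>The chance that a walk standing at \<open>t\<close> stops there: a walk at a node
  without out-neighbours has no alternative.\<close>

definition stop_prob :: "real \<Rightarrow> real" where
  "stop_prob \<alpha> = (if d t = 0 then 1 else \<alpha>)"

text \<open>A walk terminates at most once, so the probability is the expected number of visits to
  \<open>t\<close> in the first \<open>k\<close> time points times the chance of stopping per visit.
  The induction conditions on the first move.\<close>

lemma pmf_chain_walk:
  assumes "0 < \<alpha>" "\<alpha> < 1"
  shows "pmf (chain (walk_step \<alpha> G) k (At s)) (Stopped t) = stop_prob \<alpha> * (\<Sum>l<k. level (1 - \<alpha>) l s)"
proof (induction k arbitrary: s)
  case 0
  show ?case by simp
next
  case (Suc k)
  have shift: "(\<Sum>l<Suc k. level (1 - \<alpha>) l s) =
      of_bool (s = t) + (1 - \<alpha>) / real (d s) * (\<Sum>v\<in>out s. \<Sum>l<k. level (1 - \<alpha>) l v)"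
    unfolding sum.lessThan_Suc_shift by (subst sum.swap) (simp add: sum_distrib_left)
  show ?case
  proof (cases "out s = {}")
    \<comment> \<open>Here \<open>(1 - \<alpha>) / real 0 = 0\<close> removes all levels above 0,
      and if \<open>s = t\<close> then \<open>stop_prob \<alpha> = 1\<close>.\<close>
    case True
    then have "d s = 0"
      using card_out[of s] by simp
    have "walk_step \<alpha> G (At s) = return_pmf (Stopped s)"
      using True by (simp add: bind_pmf_const)
    then show ?thesis
      unfolding chain_Suc_first shift using True \<open>d s = 0\<close>
      by (auto simp: bind_return_pmf chain_Stopped stop_prob_def simp del: walk_step.simps)
  next
    case False
    then have "d s \<noteq> 0"
      using card_out[of s] finite_out[of s] by (metis card_0_eq)
    have "pmf (chain (walk_step \<alpha> G) (Suc k) (At s)) (Stopped t) =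
        \<alpha> * of_bool (s = t) + (1 - \<alpha>) * ((\<Sum>v\<in>out s. pmf (chain (walk_step \<alpha> G) k (At v)) (Stopped t)) / real (d s))"
      unfolding chain_Suc_first using assms False finite_out[of s] card_out[of s]
      by (auto simp: pmf_bind bind_assoc_pmf bind_return_pmf chain_Stopped bind_map_pmf integral_pmf_of_set)
    also have "\<dots> = stop_prob \<alpha> * (\<Sum>l<Suc k. level (1 - \<alpha>) l s)"
      unfolding shift Suc.IH using \<open>d s \<noteq> 0\<close>
      by (auto simp: stop_prob_def algebra_simps simp flip: sum_distrib_left)
    finally show ?thesis .
  qed
qed

lemma ennreal_ppr:
  assumes "0 < \<alpha>" "\<alpha> < 1"
  shows "ennreal (ppr \<alpha> G s t) = ennreal (stop_prob \<alpha>) * (\<Sum>l. ennreal (level (1 - \<alpha>) l s))"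
    and ppr_nonneg: "0 \<le> ppr \<alpha> G s t" and ppr_le_1: "ppr \<alpha> G s t \<le> 1"
proof -
  have lev: "0 \<le> level (1 - \<alpha>) l s" for l
    using assms by (intro level_nonneg) auto
  have sp: "0 < stop_prob \<alpha>"
    using assms by (simp add: stop_prob_def)
  let ?h = "\<lambda>k. pmf (chain (walk_step \<alpha> G) k (At s)) (Stopped t)"
  have bdd: "bdd_above (range ?h)"
    by (rule bdd_aboveI[of _ 1]) (auto simp: pmf_le_1)
  show "0 \<le> ppr \<alpha> G s t"
    unfolding ppr_def by (rule cSUP_upper2[OF bdd, of 0]) auto
  show "ppr \<alpha> G s t \<le> 1"
    unfolding ppr_def by (rule cSUP_least) (auto simp: pmf_le_1)
  have "incseq ?h"
  proof (rule incseq_SucI)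
    show "?h k \<le> ?h (Suc k)" for k
      unfolding pmf_chain_walk[OF assms] using sp lev by (intro mult_left_mono) simp_all
  qed
  then have "?h \<longlonglongrightarrow> ppr \<alpha> G s t"
    unfolding ppr_def by (rule LIMSEQ_incseq_SUP[OF bdd])
  then have "(\<lambda>k. ?h k / stop_prob \<alpha>) \<longlonglongrightarrow> ppr \<alpha> G s t / stop_prob \<alpha>"
    using sp by (intro tendsto_divide tendsto_const) simp_all
  moreover have "?h k / stop_prob \<alpha> = (\<Sum>l<k. level (1 - \<alpha>) l s)" for k
    unfolding pmf_chain_walk[OF assms] using sp by simp
  ultimately have sums: "(\<lambda>l. level (1 - \<alpha>) l s) sums (ppr \<alpha> G s t / stop_prob \<alpha>)"
    unfolding sums_def by (simp only:)
  have "(\<Sum>l. ennreal (level (1 - \<alpha>) l s)) = ennreal (ppr \<alpha> G s t / stop_prob \<alpha>)"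
    unfolding sums_unique[OF sums] by (rule suminf_ennreal2[OF lev sums_summable[OF sums]])
  also have "ennreal (stop_prob \<alpha>) * \<dots> = ennreal (ppr \<alpha> G s t)"
    using sp ennreal_mult'[of "stop_prob \<alpha>" "ppr \<alpha> G s t / stop_prob \<alpha>"] by simp
  finally show "ennreal (ppr \<alpha> G s t) = ennreal (stop_prob \<alpha>) * (\<Sum>l. ennreal (level (1 - \<alpha>) l s))"
    by (rule sym)
qed

lemma set_generation: "ys \<in> set_pmf (generation Q x xs) \<Longrightarrow> set ys \<subseteq> pverts G"
proof (induction xs arbitrary: ys)
  case (Cons v xs)
  then obtain as bs where "ys = as @ bs" and as: "as \<in> set_pmf (prefix_pmf d x (in_list Q v))"
    and bs: "bs \<in> set_pmf (generation Q x xs)" by auto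
  moreover have "set as \<subseteq> set (in_list Q v)"
    using set_prefix_pmf[OF as] by auto
  ultimately show ?case
    using Cons.IH[OF bs] edge_verts by (auto simp: set_in_list)
qed simp

lemma set_chain_generation: "ys \<in> set_pmf (chain (generation Q x) l [t]) \<Longrightarrow> set ys \<subseteq> pverts G"
  using target by (cases l) (auto dest: set_generation[THEN subsetD])

lemma set_trial: "ys \<in> set_pmf (trial Q x \<beta> [t]) \<Longrightarrow> set ys \<subseteq> pverts G"
  by (auto simp: trial_def dest: set_chain_generation[THEN subsetD])

section \<open>Moments of a complete trial\<close>

context
  fixes \<alpha> \<beta> x :: real
  assumes \<alpha>: "0 < \<alpha>" "\<alpha> < 1" and \<beta>: "0 < \<beta>" "\<beta> < 1" and x: "0 < x" "x < 1"
    and discount: "(1 - \<beta>) * x = 1 - \<alpha>"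
begin

text \<open>Reaching round \<open>l\<close> has weight \<open>(1 - \<beta>) ^ l\<close>; by
  \<open>discount\<close> and \<open>level_scale\<close> it turns \<open>level x\<close> into
  \<open>level (1 - \<alpha>)\<close>, whose sum over \<open>l\<close> is the series for
  \<open>ppr\<close>.\<close>

lemma nn_integral_count_trial:
  "(\<integral>\<^sup>+ ys. ennreal (real (count_list ys u)) \<partial>trial Q x \<beta> [t]) =
     ennreal (\<beta> * ppr \<alpha> G u t / stop_prob \<alpha>)"
proof -
  have sp: "0 < stop_prob \<alpha>"
    using \<alpha> by (simp add: stop_prob_def)
  have "(\<integral>\<^sup>+ ys. ennreal (real (count_list ys u)) \<partial>trial Q x \<beta> [t]) =
      ennreal \<beta> * (\<Sum>l. ennreal (level (1 - \<alpha>) l u))"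
    using \<beta> by (simp add: trial_def nn_integral_count_chain[OF x] nn_integral_geometric_pmf level_scale
        flip: discount ennreal_mult')
  also have "\<dots> = ennreal (\<beta> / stop_prob \<alpha>) * (ennreal (stop_prob \<alpha>) * (\<Sum>l. ennreal (level (1 - \<alpha>) l u)))"
    using sp \<beta> by (simp flip: mult.assoc ennreal_mult')
  also have "\<dots> = ennreal (\<beta> * ppr \<alpha> G u t / stop_prob \<alpha>)"
    using sp \<beta> by (simp add: ppr_nonneg[OF \<alpha>] flip: ennreal_ppr[OF \<alpha>] ennreal_mult')
  finally show ?thesis .
qed

text \<open>The bound for each round is linear in the mean, with a factor independent of the round,
  so it survives averaging over the clock.\<close>

lemma nn_integral_count_sq_trial:
  "(\<integral>\<^sup>+ ys. ennreal ((real (count_list ys u))\<^sup>2) \<partial>trial Q x \<beta> [t]) \<le>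
     ennreal (1 / (1 - x)) * (\<integral>\<^sup>+ ys. ennreal (real (count_list ys u)) \<partial>trial Q x \<beta> [t])"
proof -
  have "(\<integral>\<^sup>+ ys. ennreal ((real (count_list ys u))\<^sup>2) \<partial>trial Q x \<beta> [t]) \<le>
      (\<integral>\<^sup>+ l. ennreal (1 / (1 - x)) * ennreal (level x l u) \<partial>geometric_pmf \<beta>)"
    using nn_integral_count_sq_chain[OF x] x
    by (auto simp: trial_def intro!: nn_integral_mono simp flip: ennreal_mult')
  then show ?thesis
    by (simp add: nn_integral_cmult trial_def nn_integral_count_chain[OF x])
qed

definition trial_mean :: real where
  "trial_mean = \<beta> * (real n * pagerank \<alpha> G t) / stop_prob \<alpha>"

lemma nn_integral_length_trial:
  "(\<integral>\<^sup>+ ys. ennreal (real (length ys)) \<partial>trial Q x \<beta> [t]) = ennreal trial_mean"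
proof -
  have sp: "0 < stop_prob \<alpha>"
    using \<alpha> by (simp add: stop_prob_def)
  have "n \<noteq> 0"
    using target finite_verts by auto
  have "(\<integral>\<^sup>+ ys. ennreal (real (length ys)) \<partial>trial Q x \<beta> [t]) =
      (\<integral>\<^sup>+ ys. (\<Sum>u\<in>pverts G. ennreal (real (count_list ys u))) \<partial>trial Q x \<beta> [t])"
    by (intro nn_integral_cong_AE)
      (auto simp: AE_measure_pmf_iff length_eq_sum_count[OF finite_verts] dest: set_trial)
  also have "\<dots> = (\<Sum>u\<in>pverts G. ennreal (\<beta> * ppr \<alpha> G u t / stop_prob \<alpha>))"
    by (simp add: nn_integral_sum nn_integral_count_trial del: sum_ennreal)
  also have "\<dots> = ennreal (\<Sum>u\<in>pverts G. \<beta> * ppr \<alpha> G u t / stop_prob \<alpha>)"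
    using sp \<beta> by (intro sum_ennreal) (simp add: ppr_nonneg[OF \<alpha>])
  also have "(\<Sum>u\<in>pverts G. \<beta> * ppr \<alpha> G u t / stop_prob \<alpha>) = trial_mean"
    using \<open>n \<noteq> 0\<close> by (simp add: trial_mean_def pagerank_def sum_distrib_left sum_divide_distrib)
  finally show ?thesis .
qed

text \<open>Cauchy-Schwarz replaces the square of the total by \<open>n\<close> times the sum of the
  squared counts, so only second moments at single nodes enter.\<close>

lemma nn_integral_length_sq_trial:
  "(\<integral>\<^sup>+ ys. ennreal ((real (length ys))\<^sup>2) \<partial>trial Q x \<beta> [t]) \<le> ennreal (real n / (1 - x) * trial_mean)"
proof -
  let ?c = "\<lambda>ys u. real (count_list ys u)"
  have "(\<integral>\<^sup>+ ys. ennreal ((real (length ys))\<^sup>2) \<partial>trial Q x \<beta> [t]) \<le>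
      (\<integral>\<^sup>+ ys. ennreal (real n) * (\<Sum>u\<in>pverts G. ennreal ((?c ys u)\<^sup>2)) \<partial>trial Q x \<beta> [t])"
  proof (intro nn_integral_mono_AE, unfold AE_measure_pmf_iff, intro ballI)
    fix ys assume "ys \<in> set_pmf (trial Q x \<beta> [t])"
    then have "real (length ys) = (\<Sum>u\<in>pverts G. ?c ys u)"
      by (intro length_eq_sum_count finite_verts set_trial)
    then have "(real (length ys))\<^sup>2 \<le> real n * (\<Sum>u\<in>pverts G. (?c ys u)\<^sup>2)"
      using sum_squared_le_sum_of_squares[of "?c ys" "pverts G"] by (simp add: mult.commute)
    then show "ennreal ((real (length ys))\<^sup>2) \<le> ennreal (real n) * (\<Sum>u\<in>pverts G. ennreal ((?c ys u)\<^sup>2))"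
      by (simp add: ennreal_leI flip: ennreal_mult')
  qed
  also have "\<dots> = ennreal (real n) *
      (\<Sum>u\<in>pverts G. \<integral>\<^sup>+ ys. ennreal ((?c ys u)\<^sup>2) \<partial>trial Q x \<beta> [t])"
    by (simp add: nn_integral_cmult nn_integral_sum del: sum_ennreal)
  also have "\<dots> \<le> ennreal (real n) *
      (\<Sum>u\<in>pverts G. ennreal (1 / (1 - x)) * (\<integral>\<^sup>+ ys. ennreal (?c ys u) \<partial>trial Q x \<beta> [t]))"
    by (intro mult_left_mono sum_mono nn_integral_count_sq_trial) simp
  also have "\<dots> = ennreal (real n) * (ennreal (1 / (1 - x)) *
      (\<integral>\<^sup>+ ys. (\<Sum>u\<in>pverts G. ennreal (?c ys u)) \<partial>trial Q x \<beta> [t]))"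
    by (simp add: nn_integral_sum sum_distrib_left del: sum_ennreal)
  also have "(\<integral>\<^sup>+ ys. (\<Sum>u\<in>pverts G. ennreal (?c ys u)) \<partial>trial Q x \<beta> [t]) = ennreal trial_mean"
    unfolding nn_integral_length_trial[symmetric]
    by (intro nn_integral_cong_AE)
      (auto simp: AE_measure_pmf_iff length_eq_sum_count[OF finite_verts] dest: set_trial)
  also have "ennreal (real n) * (ennreal (1 / (1 - x)) * ennreal trial_mean) = ennreal (real n / (1 - x) * trial_mean)"
    using x by (simp flip: ennreal_mult')
  finally show ?thesis .
qed

text \<open>The walk from \<open>t\<close> already contributes \<open>stop_prob \<alpha>\<close>
  through its first step, and every \<open>ppr\<close> is at most 1. The lower bound lets the mean
  pay for the fixed overhead of a trial; the upper one keeps a single trial small against the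
  threshold \<open>K * n\<close>.\<close>

lemma trial_mean_ge: "\<beta> \<le> trial_mean" and trial_mean_le: "trial_mean \<le> \<beta> / \<alpha> * real n"
proof -
  have sp: "0 < stop_prob \<alpha>" "\<alpha> \<le> stop_prob \<alpha>"
    using \<alpha> by (simp_all add: stop_prob_def)
  have n: "real n * pagerank \<alpha> G t = (\<Sum>u\<in>pverts G. ppr \<alpha> G u t)"
    using target finite_verts by (auto simp: pagerank_def)
  have "stop_prob \<alpha> = pmf (chain (walk_step \<alpha> G) 1 (At t)) (Stopped t)"
    unfolding pmf_chain_walk[OF \<alpha>] by (simp)
  also have "\<dots> \<le> ppr \<alpha> G t t"
    unfolding ppr_def by (intro cSUP_upper bdd_aboveI[of _ 1]) (auto simp: pmf_le_1)
  also have "\<dots> \<le> (\<Sum>u\<in>pverts G. ppr \<alpha> G u t)"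
    using target finite_verts ppr_nonneg[OF \<alpha>] by (intro member_le_sum) auto
  finally have "\<beta> * stop_prob \<alpha> \<le> \<beta> * (\<Sum>u\<in>pverts G. ppr \<alpha> G u t)"
    using \<beta> by simp
  then show "\<beta> \<le> trial_mean"
    unfolding trial_mean_def n using sp by (simp add: field_simps)
  have s: "(\<Sum>u\<in>pverts G. ppr \<alpha> G u t) \<le> real n"
    using sum_mono[of "pverts G" "\<lambda>u. ppr \<alpha> G u t" "\<lambda>_. 1"] ppr_le_1[OF \<alpha>] by simp
  have "trial_mean \<le> \<beta> * real n / stop_prob \<alpha>"
    using s sp \<beta> by (simp add: trial_mean_def n divide_right_mono)
  also have "\<dots> \<le> \<beta> * real n / \<alpha>"
    using sp \<alpha> \<beta> by (intro divide_left_mono) auto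
  finally show "trial_mean \<le> \<beta> / \<alpha> * real n"
    by simp
qed

end
end

section \<open>The program\<close>

abbreviation cell :: "nat \<Rightarrow> nexp" where
  "cell k \<equiv> NLoad (NConst k)"

text \<open>Survival \<open>1 - \<alpha> / 2\<close> is the midpoint of \<open>1 - \<alpha>\<close>
  and 1, and \<open>beta\<close> is then forced by \<open>(1 - \<beta>) * x = 1 - \<alpha>\<close>.
  Both the clock and the branching stay subcritical, and
  \<open>1 / (1 - x) = 2 / \<alpha>\<close>.\<close>

definition beta :: "real \<Rightarrow> real" where
  "beta \<alpha> = \<alpha> / (2 - \<alpha>)"

definition survival :: "real \<Rightarrow> real" where
  "survival \<alpha> = (2 - \<alpha>) / 2"

definition beta_exp :: rexp where
  "beta_exp = RDiv (RLoad (NConst 0)) (RSub (OfNat (NConst 2)) (RLoad (NConst 0)))"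

definition survival_exp :: rexp where
  "survival_exp = RDiv (RSub (OfNat (NConst 2)) (RLoad (NConst 0))) (OfNat (NConst 2))"

text \<open>Integer cells: 2 holds the total size of all trials so far and 3 their number; 4 is the coin;
  from 10 onwards the particles of the current trial are listed in order of creation. Cells 5 to 7
  are addresses in that list: 5 the next particle to be processed, 6 the end of the list, 7 the end of
  the current generation. Cell 8 is the position in the list of in-neighbours of the particle being
  processed, and real cell 3 the out-degree of the previous one of them.

  Only the outcome of the coin decides whether the particle written at the end of the list is kept,
  so that a step of \<open>spawn_loop\<close> needs no case distinction.\<close>

definition spawn_loop :: com where
  "spawn_loop =
     While (BAnd (NLess (NConst 0) (cell 4)) (NLess (cell 8) (DegIn (NLoad (cell 5)))))
      (Seq (NStore (NConst 8) (NAdd (cell 8) (NConst 1)))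
      (Seq (NStore (cell 6) (InSorted (NLoad (cell 5)) (cell 8)))
      (Seq (Flip (NConst 4) (RDiv (RLoad (NConst 3)) (OfNat (DegOut (NLoad (cell 6))))))
      (Seq (RStore (NConst 3) (OfNat (DegOut (NLoad (cell 6)))))
           (NStore (NConst 6) (NAdd (cell 6) (cell 4)))))))"

definition level_loop :: com where
  "level_loop =
     While (NLess (cell 5) (cell 7))
      (Seq (NStore (NConst 8) (NConst 0))
      (Seq (NStore (NConst 4) (NConst 1))
      (Seq (RStore (NConst 3) survival_exp)
      (Seq spawn_loop
           (NStore (NConst 5) (NAdd (cell 5) (NConst 1)))))))"

definition trial_loop :: com where
  "trial_loop =
     While (NLess (cell 4) (NConst 1))
      (Seq (NStore (NConst 7) (cell 6))
      (Seq level_loop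
           (Flip (NConst 4) beta_exp)))"

definition trial_com :: com where
  "trial_com =
      (Seq (NStore (NConst 10) (cell 1))
      (Seq (NStore (NConst 5) (NConst 10))
      (Seq (NStore (NConst 6) (NConst 11))
      (Seq (Flip (NConst 4) beta_exp)
      (Seq trial_loop
      (Seq (NStore (NConst 2) (NAdd (cell 2) (NSub (cell 6) (cell 5))))
           (NStore (NConst 3) (NAdd (cell 3) (NConst 1)))))))))"

text \<open>If \<open>R\<close> trials were made, \<open>K * n / R\<close> estimates the mean trial
  size. The output multiplies this by \<open>stop_prob \<alpha> / (beta \<alpha> * n)\<close>, which
  is \<open>(2 - \<alpha>) / n\<close>, divided by \<alpha> if \<open>t\<close> has no
  out-neighbours.\<close>

definition pagerank_com :: "nat \<Rightarrow> com" where
  "pagerank_com K =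
      Seq (While (RLess (OfNat (cell 2)) (RMul (OfNat (NConst K)) (OfNat (cell 0)))) trial_com)
        (let e = RDiv (RMul (OfNat (NConst K)) (RSub (OfNat (NConst 2)) (RLoad (NConst 0)))) (OfNat (cell 3))
         in Cond (NLess (NConst 0) (DegOut (cell 1)))
              (RStore (NConst 0) e) (RStore (NConst 0) (RDiv e (RLoad (NConst 0)))))"

definition seg :: "memory \<Rightarrow> nat \<Rightarrow> nat \<Rightarrow> nat list" where
  "seg m a b = map (nmem m) [nmem m a..<nmem m b]"

text \<open>As a bound on a cost, the value \<open>\<top>\<close> claims nothing: \<open>guarded P v\<close> is the bound \<open>v\<close> under the
  precondition \<open>P\<close>.\<close>

definition guarded :: "bool \<Rightarrow> ennreal \<Rightarrow> ennreal" where
  "guarded P v = (if P then v else \<top>)"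

lemma guarded_True [simp]: "P \<Longrightarrow> guarded P v = v"
  by (simp add: guarded_def)

lemma le_guardedI: "(P \<Longrightarrow> u \<le> v) \<Longrightarrow> u \<le> guarded P v"
  by (simp add: guarded_def)

lemma tick_simps:
  fixes \<tau> y :: ennreal
  shows "\<tau> + \<tau> = 2 * \<tau>" "\<tau> + (\<tau> + y) = 2 * \<tau> + y"
    "\<tau> + numeral k * \<tau> = (1 + numeral k) * \<tau>" "\<tau> + (numeral k * \<tau> + y) = (1 + numeral k) * \<tau> + y"
  by (simp_all only: mult_2 distrib_right mult_1 add_ac)

section \<open>Cost of the two inner loops\<close>

context
  fixes Q :: graph_access and \<tau> :: ennreal and n t :: nat and \<alpha> :: real
begin

definition inv0 :: "memory \<Rightarrow> bool" where
  "inv0 m \<longleftrightarrow> nmem m 0 = n \<and> nmem m 1 = t \<and> rmem m 0 = \<alpha>"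

text \<open>The bound 10 keeps the list of particles apart from the control cells, so that
  assignments to the latter do not alter it.\<close>

definition inv :: "memory \<Rightarrow> bool" where
  "inv m \<longleftrightarrow> inv0 m \<and> 10 \<le> nmem m 5 \<and> nmem m 5 \<le> nmem m 7 \<and> nmem m 7 \<le> nmem m 6"

text \<open>An iteration takes 11 steps. Besides those for the accepted in-neighbours
  \<open>zs\<close> there is at most one for a rejected candidate, and the last test adds 1, hence
  12; if the list is exhausted without a rejection, 12 is an overestimate.\<close>

lemma ert_spawn_loop:
  fixes F :: "nat list \<Rightarrow> nat list \<Rightarrow> nat \<Rightarrow> nat \<Rightarrow> ennreal"
  shows "ert Q \<tau> spawn_loop
      (\<lambda>m. guarded (inv m \<and> nmem m 5 < nmem m 7) (F (seg m 5 7) (seg m 7 6) (nmem m 2) (nmem m 3))) m \<le>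
    guarded (inv m \<and> nmem m 5 < nmem m 7 \<and> nmem m 8 \<le> deg_in Q (nmem m (nmem m 5)))
     (if 0 < nmem m 4
      then \<integral>\<^sup>+ zs. F (seg m 5 7) (seg m 7 6 @ zs) (nmem m 2) (nmem m 3) + of_nat (12 + 11 * length zs) * \<tau>
        \<partial>prefix_pmf (deg_out Q) (rmem m 3) (drop (nmem m 8) (in_list Q (nmem m (nmem m 5))))
      else \<tau> + F (seg m 5 7) (seg m 7 6) (nmem m 2) (nmem m 3))"
    (is "_ \<le> ?I m")
  unfolding spawn_loop_def
proof (rule ert_While_le, rule le_guardedI, goal_cases)
  case (1 m)
  define h e T v i where "h = nmem m 5" "e = nmem m 7" "T = nmem m 6" "v = nmem m h" "i = nmem m 8"
  note defs = this
  have inv: "10 \<le> h" "h < e" "e \<le> T" "inv0 m" and i: "i \<le> deg_in Q v"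
    using 1 by (auto simp: inv_def defs)
  let ?F = "\<lambda>zs. F (seg m 5 7) (seg m 7 6 @ zs) (nmem m 2) (nmem m 3)"
  show ?case
  proof (cases "0 < nmem m 4 \<and> i < deg_in Q v")
    case False
    show ?thesis
    proof (cases "0 < nmem m 4")
      case True
      with False i have "drop i (in_list Q v) = []"
        by (simp add: in_list_def)
      moreover have "\<tau> + F (seg m 5 7) (seg m 7 6) (nmem m 2) (nmem m 3) \<le>
          F (seg m 5 7) (seg m 7 6) (nmem m 2) (nmem m 3) + 12 * \<tau>"
        by (subst add.commute, intro add_left_mono) (use mult_right_mono[of 1 12 \<tau>] in simp)
      ultimately show ?thesis
        using True False 1 by (simp add: defs)
    next
      case False
      then show ?thesis using 1 by simp
    qed
  next
    case True
    define u where "u = in_sorted Q v (Suc i)"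
    have us: "drop i (in_list Q v) = u # drop (Suc i) (in_list Q v)"
      using True by (simp add: in_list_def u_def Cons_nth_drop_Suc[symmetric] del: upt_Suc)
    define M where "M b = (nmem m)(8 := Suc i, T := u, 4 := of_bool b, 6 := T + of_bool b)" for b
    define m' where "m' b = m\<lparr>nmem := M b, rmem := (rmem m)(3 := real (deg_out Q u))\<rparr>" for b
    have M: "M b 0 = nmem m 0" "M b (Suc 0) = nmem m (Suc 0)" "M b 2 = nmem m 2" "M b 3 = nmem m 3" "M b 5 = h"
      "M b 7 = e" "M b 6 = T + of_bool b" "M b 4 = of_bool b" "M b 8 = Suc i" "M b T = u" for b
      using inv by (auto simp: M_def defs)
    have M_seg: "M b j = nmem m j" if "10 \<le> j" "j \<noteq> T" for b j
      using inv that by (auto simp: M_def)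
    have seg57: "seg (m' b) 5 7 = seg m 5 7" for b
      using inv M_seg by (auto simp: seg_def m'_def M simp flip: defs)
    have seg76: "seg (m' b) 7 6 = (if b then seg m 7 6 @ [u] else seg m 7 6)" for b
      using inv M_seg by (auto simp: seg_def m'_def M simp flip: defs)
    have I: "?I (m' b) = (if b
        then \<integral>\<^sup>+ zs. ?F (u # zs) + of_nat (12 + 11 * length zs) * \<tau>
          \<partial>prefix_pmf (deg_out Q) (real (deg_out Q u)) (drop (Suc i) (in_list Q v))
        else \<tau> + ?F [])" for b
      using inv True M_seg[of h b] unfolding seg57 seg76
      by (subst guarded_True) (auto simp: inv_def inv0_def m'_def M defs(4))
    have "\<tau> + ert Q \<tau>
      (Seq (NStore (NConst 8) (NAdd (cell 8) (NConst 1)))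
      (Seq (NStore (cell 6) (InSorted (NLoad (cell 5)) (cell 8)))
      (Seq (Flip (NConst 4) (RDiv (RLoad (NConst 3)) (OfNat (DegOut (NLoad (cell 6))))))
      (Seq (RStore (NConst 3) (OfNat (DegOut (NLoad (cell 6)))))
           (NStore (NConst 6) (NAdd (cell 6) (cell 4))))))) (\<lambda>m. \<tau> + J m) m =
      (\<integral>\<^sup>+ b. 11 * \<tau> + J (m' b) \<partial>bernoulli_pmf (rmem m 3 / real (deg_out Q u)))" for J
      using inv by (cases m) (simp add: nn_integral_add tick_simps m'_def M_def u_def defs)
    then have "\<tau> + ert Q \<tau>
      (Seq (NStore (NConst 8) (NAdd (cell 8) (NConst 1)))
      (Seq (NStore (cell 6) (InSorted (NLoad (cell 5)) (cell 8)))
      (Seq (Flip (NConst 4) (RDiv (RLoad (NConst 3)) (OfNat (DegOut (NLoad (cell 6))))))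
      (Seq (RStore (NConst 3) (OfNat (DegOut (NLoad (cell 6)))))
           (NStore (NConst 6) (NAdd (cell 6) (cell 4))))))) (\<lambda>m. \<tau> + ?I m) m =
      (\<integral>\<^sup>+ b. 11 * \<tau> + ?I (m' b) \<partial>bernoulli_pmf (rmem m 3 / real (deg_out Q u)))" .
    also have "\<dots> \<le> (\<integral>\<^sup>+ b. \<integral>\<^sup>+ zs. ?F zs + of_nat (12 + 11 * length zs) * \<tau>
        \<partial>(if b then map_pmf ((#) u) (prefix_pmf (deg_out Q) (real (deg_out Q u)) (drop (Suc i) (in_list Q v)))
          else return_pmf []) \<partial>bernoulli_pmf (rmem m 3 / real (deg_out Q u)))"
    proof (unfold I, intro nn_integral_mono eq_refl, goal_cases)
      case (1 b)
      have tick: "11 * \<tau> + (A + of_nat k * \<tau>) = A + of_nat (11 + k) * \<tau>" for A k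
        by (simp only: of_nat_add of_nat_numeral distrib_right add_ac)
      have len: "11 + (12 + 11 * length zs) = 12 + 11 * length (u # zs)" for zs
        by simp
      show ?case
      proof (cases b)
        case True
        have "11 * \<tau> + (\<integral>\<^sup>+ zs. ?F (u # zs) + of_nat (12 + 11 * length zs) * \<tau> \<partial>measure_pmf P) =
            (\<integral>\<^sup>+ zs. 11 * \<tau> + (?F (u # zs) + of_nat (12 + 11 * length zs) * \<tau>) \<partial>measure_pmf P)" for P :: "nat list pmf"
          by (subst nn_integral_add) simp_all
        with True show ?thesis
          by (simp only: if_True nn_integral_map_pmf tick len)
      next
        case False
        have "(12 :: ennreal) = 11 + 1"
          by simp
        then have "11 * \<tau> + (\<tau> + ?F []) = ?F [] + 12 * \<tau>"
          by (simp only: distrib_right mult_1 add_ac)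
        moreover have "(\<integral>\<^sup>+ zs. ?F zs + of_nat (12 + 11 * length zs) * \<tau> \<partial>return_pmf []) = ?F [] + 12 * \<tau>"
          by simp
        ultimately show ?thesis
          using False by (simp only: if_False)
      qed
    qed
    also have "\<dots> = (\<integral>\<^sup>+ zs. ?F zs + of_nat (12 + 11 * length zs) * \<tau>
        \<partial>prefix_pmf (deg_out Q) (rmem m 3) (drop i (in_list Q v)))"
      by (simp add: us)
    also have "(\<integral>\<^sup>+ zs. ?F zs + of_nat (12 + 11 * length zs) * \<tau>
        \<partial>prefix_pmf (deg_out Q) (rmem m 3) (drop i (in_list Q v))) = (if 0 < nmem m 4
      then \<integral>\<^sup>+ zs. ?F zs + of_nat (12 + 11 * length zs) * \<tau>
        \<partial>prefix_pmf (deg_out Q) (rmem m 3) (drop (nmem m 8) (in_list Q (nmem m (nmem m 5))))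
      else \<tau> + F (seg m 5 7) (seg m 7 6) (nmem m 2) (nmem m 3))"
      using True by (simp add: defs)
    moreover have "bval Q m (BAnd (NLess (NConst 0) (cell 4)) (NLess (cell 8) (DegIn (NLoad (cell 5)))))"
      using True by (simp add: defs)
    ultimately show ?thesis
      by (simp only: if_True)
  qed
qed

lemma seg_conv_Cons: "seg m a b = (if nmem m a < nmem m b then nmem m (nmem m a) # map (nmem m) [Suc (nmem m a)..<nmem m b] else [])"
  by (simp add: seg_def upt_conv_Cons)

text \<open>Each processed particle costs 10 steps of bookkeeping and the constant 12 of
  \<open>ert_spawn_loop\<close>, each child costs 11, and the last test costs 1.\<close>

lemma ert_level_loop:
  fixes F :: "nat list \<Rightarrow> nat \<Rightarrow> nat \<Rightarrow> ennreal"
  shows "ert Q \<tau> level_loop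
      (\<lambda>m. guarded (inv m \<and> nmem m 5 = nmem m 7) (F (seg m 7 6) (nmem m 2) (nmem m 3))) m \<le>
    guarded (inv m)
     (\<integral>\<^sup>+ zs. F (seg m 7 6 @ zs) (nmem m 2) (nmem m 3) + of_nat (1 + 22 * length (seg m 5 7) + 11 * length zs) * \<tau>
        \<partial>generation Q (survival \<alpha>) (seg m 5 7))"
    (is "_ \<le> ?I m")
  unfolding level_loop_def
proof (rule ert_While_le, rule le_guardedI, goal_cases)
  case (1 m)
  let ?D = "NStore (NConst 5) (NAdd (cell 5) (NConst 1))"
  let ?F = "\<lambda>cur nxt S R. 3 * \<tau> +
     (\<integral>\<^sup>+ zs. F (nxt @ zs) S R + of_nat (1 + 22 * length (tl cur) + 11 * length zs) * \<tau>
        \<partial>generation Q (survival \<alpha>) (tl cur))"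
  show ?case
  proof (cases "nmem m 5 < nmem m 7")
    case False
    then show ?thesis
      using 1 by (simp add: inv_def seg_conv_Cons add.commute)
  next
    case True
    have post: "\<tau> + ert Q \<tau> ?D (\<lambda>m. \<tau> + ?I m) m \<le>
        guarded (inv m \<and> nmem m 5 < nmem m 7) (?F (seg m 5 7) (seg m 7 6) (nmem m 2) (nmem m 3))" for m
    proof (rule le_guardedI, goal_cases)
      case 1
      let ?m = "m\<lparr>nmem := (nmem m)(5 := Suc (nmem m 5))\<rparr>"
      have "inv ?m"
        using 1 by (auto simp: inv_def inv0_def)
      moreover have "seg ?m 5 7 = tl (seg m 5 7)" "seg ?m 7 6 = seg m 7 6"
        using 1 by (auto simp: inv_def seg_def upt_conv_Cons)
      ultimately have "?I ?m = (\<integral>\<^sup>+ zs. F (seg m 7 6 @ zs) (nmem m 2) (nmem m 3) +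
          of_nat (1 + 22 * length (tl (seg m 5 7)) + 11 * length zs) * \<tau>
        \<partial>generation Q (survival \<alpha>) (tl (seg m 5 7)))"
        by (subst guarded_True) simp_all
      moreover have "\<tau> + ert Q \<tau> ?D (\<lambda>m. \<tau> + ?I m) m = 3 * \<tau> + ?I ?m"
        by (simp add: tick_simps)
      ultimately show ?case
        by (simp only: order_refl)
    qed
    let ?v = "nmem m (nmem m 5)" and ?cur = "seg m 5 7" and ?nxt = "seg m 7 6" and ?S = "nmem m 2" and ?R = "nmem m 3"
    let ?m = "m\<lparr>nmem := (nmem m)(8 := 0, 4 := Suc 0), rmem := (rmem m)(3 := survival \<alpha>)\<rparr>"
    have inv: "inv ?m" "nmem ?m 5 < nmem ?m 7"
      using 1 True by (auto simp: inv_def inv0_def)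
    have segs: "seg ?m 5 7 = ?cur" "seg ?m 7 6 = ?nxt"
      using 1 by (auto simp: inv_def seg_def)
    have v: "nmem ?m (nmem ?m 5) = ?v" "?cur = ?v # tl ?cur"
      using 1 True by (auto simp: inv_def seg_conv_Cons)
    have "rmem m 0 = \<alpha>"
      using 1 by (simp add: inv_def inv0_def)
    then have "\<tau> + ert Q \<tau>
      (Seq (NStore (NConst 8) (NConst 0))
      (Seq (NStore (NConst 4) (NConst 1))
      (Seq (RStore (NConst 3) survival_exp)
      (Seq spawn_loop ?D)))) J m = 7 * \<tau> + ert Q \<tau> spawn_loop (\<lambda>m. \<tau> + ert Q \<tau> ?D J m) ?m" for J
      by (simp add: tick_simps survival_exp_def survival_def)
    then have "\<tau> + ert Q \<tau>
      (Seq (NStore (NConst 8) (NConst 0))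
      (Seq (NStore (NConst 4) (NConst 1))
      (Seq (RStore (NConst 3) survival_exp)
      (Seq spawn_loop ?D)))) (\<lambda>m. \<tau> + ?I m) m =
      7 * \<tau> + ert Q \<tau> spawn_loop (\<lambda>m. \<tau> + ert Q \<tau> ?D (\<lambda>m. \<tau> + ?I m) m) ?m" .
    also have "\<dots> \<le> 7 * \<tau> + ert Q \<tau> spawn_loop
      (\<lambda>m. guarded (inv m \<and> nmem m 5 < nmem m 7) (?F (seg m 5 7) (seg m 7 6) (nmem m 2) (nmem m 3))) ?m"
      by (intro add_left_mono ert_mono post)
    also have "\<dots> \<le> 7 * \<tau> +
       (\<integral>\<^sup>+ ys. ?F ?cur (?nxt @ ys) ?S ?R + of_nat (12 + 11 * length ys) * \<tau>
        \<partial>prefix_pmf (deg_out Q) (survival \<alpha>) (in_list Q ?v))"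
    proof -
      have "nmem m 5 \<noteq> 8" "nmem m 5 \<noteq> 4"
        using 1 by (auto simp: inv_def)
      then show ?thesis
        using inv by (intro add_left_mono order_trans[OF ert_spawn_loop]) (simp add: segs)
    qed
    also have "\<dots> = (\<integral>\<^sup>+ ys. \<integral>\<^sup>+ zs. 7 * \<tau> + (3 * \<tau> +
        (F ((?nxt @ ys) @ zs) ?S ?R + of_nat (1 + 22 * length (tl ?cur) + 11 * length zs) * \<tau>) +
        of_nat (12 + 11 * length ys) * \<tau>)
        \<partial>generation Q (survival \<alpha>) (tl ?cur)
        \<partial>prefix_pmf (deg_out Q) (survival \<alpha>) (in_list Q ?v))"
      by (simp add: nn_integral_add)
    also have "\<dots> = (\<integral>\<^sup>+ zs. F (?nxt @ zs) ?S ?R + of_nat (1 + 22 * length (?v # tl ?cur) + 11 * length zs) * \<tau>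
        \<partial>generation Q (survival \<alpha>) (?v # tl ?cur))"
    proof -
      have "7 * \<tau> + (3 * \<tau> + (A + of_nat p * \<tau>) + of_nat q * \<tau>) = A + of_nat (10 + p + q) * \<tau>" for A p q
      proof -
        have "of_nat (10 + p + q) = (7 + 3 + of_nat p + of_nat q :: ennreal)" by simp
        then show ?thesis by (simp only: distrib_right add_ac)
      qed
      moreover have "10 + (1 + 22 * length (tl ?cur) + 11 * length zs) + (12 + 11 * length ys) =
          1 + 22 * length (?v # tl ?cur) + 11 * length (ys @ zs)" for ys zs :: "nat list"
        by simp
      ultimately show ?thesis
        by (simp only: append_assoc generation.simps nn_integral_bind_pmf nn_integral_map_pmf)
    qed
    finally show ?thesis
      using True by (simp flip: v(2))
  qed
qed

end

text \<open>The geometric clock is memoryless: after a first failure, what remains is a fresh trial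
  from the next generation.\<close>

lemma trial_unfold:
  assumes "0 < \<beta>" "\<beta> < 1"
  shows "trial Q x \<beta> xs =
    bind_pmf (bernoulli_pmf \<beta>) (\<lambda>b. if b then return_pmf xs else bind_pmf (generation Q x xs) (trial Q x \<beta>))"
proof -
  have "bind_pmf (geometric_pmf \<beta>) (\<lambda>l. bind_pmf (generation Q x xs) (chain (generation Q x) l)) =
      bind_pmf (generation Q x xs) (trial Q x \<beta>)"
    by (subst bind_commute_pmf) (simp add: trial_def[abs_def])
  then show ?thesis
    unfolding trial_def using assms
    by (subst geometric_bind_pmf_unfold)
      (auto simp: bind_assoc_pmf bind_return_pmf bind_map_pmf chain_Suc_first simp del: chain.simps(2)
        intro!: bind_pmf_cong)
qed

section \<open>Cost of a trial and of the whole program\<close>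

context
  fixes Q :: graph_access and \<tau> :: ennreal and n t :: nat and \<alpha> :: real
begin

text \<open>The work on all generations is charged to the final one. A generation is final with
  probability \<beta>, so a cost \<open>c\<close> for each generation becomes
  \<open>c / \<beta>\<close> at the end.\<close>

definition trial_value :: "(nat \<Rightarrow> nat \<Rightarrow> nat \<Rightarrow> ennreal) \<Rightarrow> nat \<Rightarrow> nat \<Rightarrow> nat list \<Rightarrow> ennreal" where
  "trial_value F S R zs =
     (\<integral>\<^sup>+ ys. F (length ys) S R + ennreal (8 / beta \<alpha> + 33 / beta \<alpha> * real (length ys)) * \<tau>
        \<partial>trial Q (survival \<alpha>) (beta \<alpha>) zs)"

definition trial_inv :: "memory \<Rightarrow> bool" where
  "trial_inv m \<longleftrightarrow> inv0 n t \<alpha> m \<and> 10 \<le> nmem m 5 \<and> nmem m 5 \<le> nmem m 6"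

definition estimate :: "nat \<Rightarrow> nat \<Rightarrow> real" where
  "estimate K R = real K * (2 - \<alpha>) / real R / (if 0 < deg_out Q t then 1 else \<alpha>)"

context
  assumes beta: "0 < beta \<alpha>" "beta \<alpha> < 1"
begin

text \<open>A generation of size \<open>l\<close> costs \<open>11 * l\<close> for its creation and,
  unless it is final, \<open>7 + 22 * l\<close> for its expansion, in all at most
  \<open>8 + 33 * l\<close>. The stopping branch, of probability \<beta>, pays this from its charge
  \<open>(8 + 33 * l) / \<beta>\<close>.\<close>

lemma trial_value_ge:
  "of_nat (11 * length zs) * \<tau> +
     (\<integral>\<^sup>+ b. (if b then \<tau> + F (length zs) S R
        else of_nat (7 + 22 * length zs) * \<tau> + (\<integral>\<^sup>+ ys. trial_value F S R ys \<partial>generation Q (survival \<alpha>) zs))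
        \<partial>bernoulli_pmf (beta \<alpha>)) \<le> trial_value F S R zs"
proof -
  let ?\<beta> = "beta \<alpha>" and ?l = "real (length zs)"
  let ?H = "\<integral>\<^sup>+ ys. trial_value F S R ys \<partial>generation Q (survival \<alpha>) zs" and ?G = "F (length zs) S R"
  have nn_integral_return_pmf': "(\<integral>\<^sup>+ ys. f ys \<partial>return_pmf zs) = f zs" for f :: "nat list \<Rightarrow> ennreal"
    by simp
  have bern: "(\<integral>\<^sup>+ b. f b \<partial>bernoulli_pmf ?\<beta>) = ennreal ?\<beta> * f True + ennreal (1 - ?\<beta>) * f False" for f
    using beta by (simp add: mult.commute)
  have real: "of_nat (11 * length zs) = ennreal (11 * ?l)" "of_nat (7 + 22 * length zs) = ennreal (7 + 22 * ?l)"
    unfolding ennreal_of_nat_eq_real_of_nat by simp_all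
  have sum: "ennreal (11 * ?l + ?\<beta> + (1 - ?\<beta>) * (7 + 22 * ?l)) =
      ennreal (11 * ?l) + ennreal ?\<beta> + ennreal (1 - ?\<beta>) * ennreal (7 + 22 * ?l)"
    using beta by (subst ennreal_mult'[symmetric]) (simp_all del: distrib_left_numeral)
  have "of_nat (11 * length zs) * \<tau> +
     (\<integral>\<^sup>+ b. (if b then \<tau> + ?G else of_nat (7 + 22 * length zs) * \<tau> + ?H) \<partial>bernoulli_pmf ?\<beta>) =
     ennreal (11 * ?l + ?\<beta> + (1 - ?\<beta>) * (7 + 22 * ?l)) * \<tau> + (ennreal ?\<beta> * ?G + ennreal (1 - ?\<beta>) * ?H)"
    unfolding bern real sum by (simp only: if_True if_False distrib_left distrib_right mult.assoc add_ac)
  also have "\<dots> \<le> ennreal (8 + 33 * ?l) * \<tau> + (ennreal ?\<beta> * ?G + ennreal (1 - ?\<beta>) * ?H)"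
  proof (intro add_right_mono mult_right_mono ennreal_leI)
    define P where "P = (1 - ?\<beta>) * (7 + 22 * ?l)"
    have "P \<le> 1 * (7 + 22 * ?l)"
      unfolding P_def using beta by (intro mult_right_mono) auto
    then have "P \<le> 7 + 22 * ?l"
      by simp
    then show "11 * ?l + ?\<beta> + (1 - ?\<beta>) * (7 + 22 * ?l) \<le> 8 + 33 * ?l"
      unfolding P_def[symmetric] using beta by argo
  qed simp
  also have "\<dots> = ennreal ?\<beta> * (?G + ennreal (8 / ?\<beta> + 33 / ?\<beta> * ?l) * \<tau>) + ennreal (1 - ?\<beta>) * ?H"
  proof -
    have "8 + 33 * ?l = ?\<beta> * (8 / ?\<beta> + 33 / ?\<beta> * ?l)"
      using beta by (simp add: field_simps)
    then have "ennreal (8 + 33 * ?l) = ennreal ?\<beta> * ennreal (8 / ?\<beta> + 33 / ?\<beta> * ?l)"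
      using beta by (simp only: ennreal_mult')
    then show ?thesis
      by (simp only: distrib_left mult.assoc add_ac)
  qed
  also have "\<dots> = trial_value F S R zs"
    unfolding trial_value_def[of F S R zs]
    by (subst trial_unfold[OF beta])
      (simp only: nn_integral_bind_pmf bern if_True if_False nn_integral_return_pmf' trial_value_def[abs_def])
  finally show ?thesis .
qed

lemma ert_trial_loop:
  fixes F :: "nat \<Rightarrow> nat \<Rightarrow> nat \<Rightarrow> ennreal"
  shows "ert Q \<tau> trial_loop
      (\<lambda>m. guarded (trial_inv m) (F (length (seg m 5 6)) (nmem m 2) (nmem m 3))) m \<le>
    guarded (trial_inv m)
     (if nmem m 4 < 1
      then of_nat (7 + 22 * length (seg m 5 6)) * \<tau> +
        (\<integral>\<^sup>+ zs. trial_value F (nmem m 2) (nmem m 3) zs \<partial>generation Q (survival \<alpha>) (seg m 5 6))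
      else \<tau> + F (length (seg m 5 6)) (nmem m 2) (nmem m 3))"
    (is "_ \<le> ?I m")
  unfolding trial_loop_def
proof (rule ert_While_le, rule le_guardedI, goal_cases)
  case (1 m)
  let ?D = "Flip (NConst 4) beta_exp"
  let ?F = "\<lambda>zs S R. 3 * \<tau> +
     (\<integral>\<^sup>+ b. (if b then \<tau> + F (length zs) S R
        else of_nat (7 + 22 * length zs) * \<tau> + (\<integral>\<^sup>+ ys. trial_value F S R ys \<partial>generation Q (survival \<alpha>) zs))
        \<partial>bernoulli_pmf (beta \<alpha>))"
  show ?case
  proof (cases "nmem m 4 < 1")
    case False
    then show ?thesis
      using 1 by simp
  next
    case True
    have post: "\<tau> + ert Q \<tau> ?D (\<lambda>m. \<tau> + ?I m) m \<le>
        guarded (inv n t \<alpha> m \<and> nmem m 5 = nmem m 7) (?F (seg m 7 6) (nmem m 2) (nmem m 3))" for m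
    proof (rule le_guardedI, goal_cases)
      case 1
      let ?m = "\<lambda>b. m\<lparr>nmem := (nmem m)(4 := of_bool b)\<rparr>"
      have tinv: "trial_inv (?m b)" and lv: "seg (?m b) 5 6 = seg m 7 6" for b
        using 1 by (auto simp: inv_def trial_inv_def inv0_def seg_def)
      have I: "?I (?m b) = (if b then \<tau> + F (length (seg m 7 6)) (nmem m 2) (nmem m 3)
        else of_nat (7 + 22 * length (seg m 7 6)) * \<tau> +
          (\<integral>\<^sup>+ ys. trial_value F (nmem m 2) (nmem m 3) ys \<partial>generation Q (survival \<alpha>) (seg m 7 6)))" for b
        unfolding lv guarded_True[OF tinv] by simp
      have "rmem m 0 = \<alpha>"
        using 1 by (simp add: inv_def inv0_def)
      then have "\<tau> + ert Q \<tau> ?D (\<lambda>m. \<tau> + J m) m = 3 * \<tau> + (\<integral>\<^sup>+ b. J (?m b) \<partial>bernoulli_pmf (beta \<alpha>))" for J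
        by (simp add: tick_simps beta_exp_def nn_integral_add flip: beta_def)
      then show ?case
        unfolding I[symmetric] by (simp only: order_refl)
    qed
    let ?lv = "seg m 5 6" and ?S = "nmem m 2" and ?R = "nmem m 3"
    let ?m = "m\<lparr>nmem := (nmem m)(7 := nmem m 6)\<rparr>"
    have inv: "inv n t \<alpha> ?m" and segs: "seg ?m 5 7 = ?lv" "seg ?m 7 6 = []"
      using 1 by (auto simp: inv_def inv0_def trial_inv_def seg_def)
    have "\<tau> + ert Q \<tau> (Seq (NStore (NConst 7) (cell 6)) (Seq level_loop ?D)) J m =
        3 * \<tau> + ert Q \<tau> level_loop (\<lambda>m. \<tau> + ert Q \<tau> ?D J m) ?m" for J
      by (simp add: tick_simps)
    then have "\<tau> + ert Q \<tau> (Seq (NStore (NConst 7) (cell 6)) (Seq level_loop ?D)) (\<lambda>m. \<tau> + ?I m) m =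
      3 * \<tau> + ert Q \<tau> level_loop (\<lambda>m. \<tau> + ert Q \<tau> ?D (\<lambda>m. \<tau> + ?I m) m) ?m" .
    also have "\<dots> \<le> 3 * \<tau> + ert Q \<tau> level_loop
      (\<lambda>m. guarded (inv n t \<alpha> m \<and> nmem m 5 = nmem m 7) (?F (seg m 7 6) (nmem m 2) (nmem m 3))) ?m"
      by (intro add_left_mono ert_mono post)
    also have "\<dots> \<le> 3 * \<tau> +
       (\<integral>\<^sup>+ zs. ?F zs ?S ?R + of_nat (1 + 22 * length ?lv + 11 * length zs) * \<tau> \<partial>generation Q (survival \<alpha>) ?lv)"
    proof -
      have "nmem ?m 2 = ?S" "nmem ?m 3 = ?R"
        by simp_all
      then show ?thesis
        by (intro add_left_mono order_trans[OF ert_level_loop])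
          (simp only: guarded_True[OF inv] segs append_Nil order_refl)
    qed
    \<comment> \<open>The 11 steps per child are passed to the child generation, where
      \<open>trial_value_ge\<close> absorbs them.\<close>
    also have "\<dots> \<le> 3 * \<tau> +
       (\<integral>\<^sup>+ zs. of_nat (4 + 22 * length ?lv) * \<tau> + trial_value F ?S ?R zs \<partial>generation Q (survival \<alpha>) ?lv)"
    proof (intro add_left_mono nn_integral_mono)
      fix zs :: "nat list"
      have "3 * \<tau> + A + of_nat (1 + 22 * length ?lv + 11 * length zs) * \<tau> =
        of_nat (4 + 22 * length ?lv) * \<tau> + (of_nat (11 * length zs) * \<tau> + A)" for A
      proof -
        have "(3 + of_nat (1 + 22 * length ?lv + 11 * length zs) :: ennreal) =
          of_nat (4 + 22 * length ?lv) + of_nat (11 * length zs)"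
          by simp
        from arg_cong[OF this, of "\<lambda>x. x * \<tau> + A"] show ?thesis
          by (simp only: distrib_right add_ac)
      qed
      then show "?F zs ?S ?R + of_nat (1 + 22 * length ?lv + 11 * length zs) * \<tau> \<le>
          of_nat (4 + 22 * length ?lv) * \<tau> + trial_value F ?S ?R zs"
        using add_left_mono[OF trial_value_ge] by (simp only:)
    qed
    also have "\<dots> = of_nat (7 + 22 * length ?lv) * \<tau> + (\<integral>\<^sup>+ zs. trial_value F ?S ?R zs \<partial>generation Q (survival \<alpha>) ?lv)"
    proof -
      have "of_nat (7 + 22 * length ?lv) = (3 + of_nat (4 + 22 * length ?lv) :: ennreal)"
        by simp
      then show ?thesis
        by (subst nn_integral_add) (simp_all only: distrib_right add_ac measure_pmf.emeasure_space_1 nn_integral_const mult_1_right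
            space_measure_pmf, simp_all)
    qed
    finally show ?thesis
      using True 1 by simp
  qed
qed

lemma ert_trial_com:
  fixes \<Phi> :: "nat \<Rightarrow> nat \<Rightarrow> ennreal"
  shows "ert Q \<tau> trial_com (\<lambda>m. guarded (inv0 n t \<alpha> m) (\<Phi> (nmem m 2) (nmem m 3))) m \<le>
    guarded (inv0 n t \<alpha> m)
      (8 * \<tau> + trial_value (\<lambda>l S R. 4 * \<tau> + \<Phi> (S + l) (Suc R)) (nmem m 2) (nmem m 3) [t])"
proof (rule le_guardedI)
  assume m: "inv0 n t \<alpha> m"
  let ?D = "Seq (NStore (NConst 2) (NAdd (cell 2) (NSub (cell 6) (cell 5)))) (NStore (NConst 3) (NAdd (cell 3) (NConst 1)))"
  let ?f = "\<lambda>m. guarded (inv0 n t \<alpha> m) (\<Phi> (nmem m 2) (nmem m 3))"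
  let ?F = "\<lambda>l S R. 4 * \<tau> + \<Phi> (S + l) (Suc R)"
  have post: "\<tau> + ert Q \<tau> ?D ?f m \<le> guarded (trial_inv m) (?F (length (seg m 5 6)) (nmem m 2) (nmem m 3))" for m
  proof (rule le_guardedI)
    assume m: "trial_inv m"
    let ?m = "m\<lparr>nmem := (nmem m)(2 := nmem m 2 + (nmem m 6 - nmem m 5), 3 := Suc (nmem m 3))\<rparr>"
    have "\<tau> + ert Q \<tau> ?D f m = 4 * \<tau> + f ?m" for f
      by (simp add: tick_simps)
    then have "\<tau> + ert Q \<tau> ?D ?f m = 4 * \<tau> + ?f ?m" .
    also have "\<dots> = ?F (length (seg m 5 6)) (nmem m 2) (nmem m 3)"
      using m by (simp add: trial_inv_def inv0_def seg_def)
    finally show "\<tau> + ert Q \<tau> ?D ?f m \<le> ?F (length (seg m 5 6)) (nmem m 2) (nmem m 3)"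
      by simp
  qed
  let ?m = "\<lambda>b. m\<lparr>nmem := (nmem m)(10 := t, 5 := 10, 6 := 11, 4 := of_bool b)\<rparr>"
  let ?post = "\<lambda>m. guarded (trial_inv m) (?F (length (seg m 5 6)) (nmem m 2) (nmem m 3))"
  have \<alpha>: "rmem m 0 = \<alpha>" "nmem m (Suc 0) = t"
    using m by (auto simp: inv0_def)
  then have "ert Q \<tau>
      (Seq (NStore (NConst 10) (cell 1))
      (Seq (NStore (NConst 5) (NConst 10))
      (Seq (NStore (NConst 6) (NConst 11))
      (Seq (Flip (NConst 4) beta_exp) (Seq c d))))) f m =
      8 * \<tau> + (\<integral>\<^sup>+ b. ert Q \<tau> c (\<lambda>m. \<tau> + ert Q \<tau> d f m) (?m b) \<partial>bernoulli_pmf (beta \<alpha>))" for c d f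
    by (simp add: tick_simps beta_exp_def nn_integral_add flip: beta_def)
  then have "ert Q \<tau> trial_com ?f m =
      8 * \<tau> + (\<integral>\<^sup>+ b. ert Q \<tau> trial_loop (\<lambda>m. \<tau> + ert Q \<tau> ?D ?f m) (?m b) \<partial>bernoulli_pmf (beta \<alpha>))"
    unfolding trial_com_def .
  also have "\<dots> \<le> 8 * \<tau> + (\<integral>\<^sup>+ b. ert Q \<tau> trial_loop ?post (?m b) \<partial>bernoulli_pmf (beta \<alpha>))"
    by (intro add_left_mono nn_integral_mono ert_mono post)
  also have "\<dots> \<le> 8 * \<tau> + (\<integral>\<^sup>+ b. (if b then \<tau> + ?F (length [t]) (nmem m 2) (nmem m 3)
        else of_nat (7 + 22 * length [t]) * \<tau> +
          (\<integral>\<^sup>+ ys. trial_value ?F (nmem m 2) (nmem m 3) ys \<partial>generation Q (survival \<alpha>) [t]))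
        \<partial>bernoulli_pmf (beta \<alpha>))"
  proof (intro add_left_mono nn_integral_mono, goal_cases)
    case (1 b)
    have tinv: "trial_inv (?m b)" and eqs: "seg (?m b) 5 6 = [t]" "nmem (?m b) 2 = nmem m 2" "nmem (?m b) 3 = nmem m 3"
      "nmem (?m b) 4 = of_bool b"
      using m by (auto simp: trial_inv_def inv0_def seg_def upt_rec)
    have "(if (of_bool b :: nat) < 1 then X else Y) = (if b then Y else X)" for X Y :: ennreal
      by simp
    from ert_trial_loop[of ?F "?m b", unfolded guarded_True[OF tinv] eqs this] show ?case .
  qed
  also have "\<dots> \<le> 8 * \<tau> + trial_value ?F (nmem m 2) (nmem m 3) [t]"
    using trial_value_ge[of "[t]" ?F "nmem m 2" "nmem m 3"]
    by (intro add_left_mono order_trans[OF _ trial_value_ge]) (auto intro: add_increasing)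
  finally show "ert Q \<tau> trial_com ?f m \<le> 8 * \<tau> + trial_value ?F (nmem m 2) (nmem m 3) [t]" .
qed

text \<open>This reduces the program to a potential in the total size \<open>S\<close> and the
  number \<open>R\<close> of trials. It serves twice: with \<open>\<tau> = 1\<close> for the time
  and with \<open>\<tau> = 0\<close> for the error probability.\<close>

lemma ert_pagerank_com:
  fixes \<Phi> :: "nat \<Rightarrow> nat \<Rightarrow> ennreal" and g :: "real \<Rightarrow> ennreal"
  assumes step: "\<And>S R. real S < real K * real n \<Longrightarrow>
      9 * \<tau> + trial_value (\<lambda>l S R. 5 * \<tau> + \<Phi> (S + l) (Suc R)) S R [t] \<le> \<Phi> S R"
    and exit: "\<And>S R. real K * real n \<le> real S \<Longrightarrow> 4 * \<tau> + g (estimate K R) \<le> \<Phi> S R"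
    and m: "inv0 n t \<alpha> m" "nmem m 2 = 0" "nmem m 3 = 0"
  shows "ert Q \<tau> (pagerank_com K) (\<lambda>m. g (rmem m 0)) m \<le> \<Phi> 0 0"
proof -
  let ?b = "RLess (OfNat (cell 2)) (RMul (OfNat (NConst K)) (OfNat (cell 0)))"
  let ?e = "RDiv (RMul (OfNat (NConst K)) (RSub (OfNat (NConst 2)) (RLoad (NConst 0)))) (OfNat (cell 3))"
  let ?D = "Cond (NLess (NConst 0) (DegOut (cell 1))) (RStore (NConst 0) ?e) (RStore (NConst 0) (RDiv ?e (RLoad (NConst 0))))"
  let ?I = "\<lambda>m. guarded (inv0 n t \<alpha> m) (\<Phi> (nmem m 2) (nmem m 3))"
  have "ert Q \<tau> (While ?b trial_com) (\<lambda>m. \<tau> + ert Q \<tau> ?D (\<lambda>m. g (rmem m 0)) m) m \<le> ?I m"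
  proof (rule ert_While_le, rule le_guardedI)
    fix m assume m: "inv0 n t \<alpha> m"
    have b: "bval Q m ?b \<longleftrightarrow> real (nmem m 2) < real K * real n"
      using m by (simp add: inv0_def)
    show "\<tau> + (if bval Q m ?b then ert Q \<tau> trial_com (\<lambda>m. \<tau> + ?I m) m
        else \<tau> + ert Q \<tau> ?D (\<lambda>m. g (rmem m 0)) m) \<le> \<Phi> (nmem m 2) (nmem m 3)"
    proof (cases "bval Q m ?b")
      case True
      have "ert Q \<tau> trial_com (\<lambda>m. \<tau> + ?I m) m \<le>
          ert Q \<tau> trial_com (\<lambda>m. guarded (inv0 n t \<alpha> m) (\<tau> + \<Phi> (nmem m 2) (nmem m 3))) m"
        by (rule ert_mono) (simp add: guarded_def)
      also have "\<dots> \<le> 8 * \<tau> + trial_value (\<lambda>l S R. 4 * \<tau> + (\<tau> + \<Phi> (S + l) (Suc R))) (nmem m 2) (nmem m 3) [t]"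
        using ert_trial_com[of "\<lambda>S R. \<tau> + \<Phi> S R" m] m by simp
      finally have "\<tau> + ert Q \<tau> trial_com (\<lambda>m. \<tau> + ?I m) m \<le>
        \<tau> + (8 * \<tau> + trial_value (\<lambda>l S R. 4 * \<tau> + (\<tau> + \<Phi> (S + l) (Suc R))) (nmem m 2) (nmem m 3) [t])"
        by (rule add_left_mono)
      also have "\<dots> = 9 * \<tau> + trial_value (\<lambda>l S R. 5 * \<tau> + \<Phi> (S + l) (Suc R)) (nmem m 2) (nmem m 3) [t]"
      proof -
        have five: "4 * \<tau> + (\<tau> + A) = 5 * \<tau> + A" for A
          using tick_simps(4)[of \<tau> "num.Bit0 (num.Bit0 num.One)" A] by (simp add: add.left_commute)
        show ?thesis
          unfolding five by (simp add: tick_simps)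
      qed
      also have "\<dots> \<le> \<Phi> (nmem m 2) (nmem m 3)"
        using True b by (intro step) simp
      finally show ?thesis
        using True by (simp only: if_True)
    next
      case False
      have "(4 :: ennreal) = 3 + 1"
        by simp
      then have "3 * \<tau> + \<tau> = 4 * \<tau>"
        by (simp only: distrib_right mult_1)
      then have "\<tau> + (\<tau> + ert Q \<tau> ?D (\<lambda>m. g (rmem m 0)) m) = 4 * \<tau> + g (estimate K (nmem m 3))"
        using m by (simp add: tick_simps inv0_def estimate_def)
      also have "\<dots> \<le> \<Phi> (nmem m 2) (nmem m 3)"
        using False b by (intro exit) simp
      finally show ?thesis
        using False by (simp only: if_False)
    qed
  qed
  then show ?thesis
    using m by (simp add: pagerank_com_def Let_def)
qed

end
end

section \<open>Time and error bounds\<close>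

text \<open>The coefficient \<open>b\<close> may be negative, so linearity is used for Bochner
  integrals. The second moment is only bounded from above, whence \<open>c \<ge> 0\<close>.\<close>

lemma nn_integral_quadratic_le:
  fixes M :: "'a pmf" and X :: "'a \<Rightarrow> real"
  assumes mean: "(\<integral>\<^sup>+ y. ennreal (X y) \<partial>M) = ennreal \<mu>" and X: "\<And>y. 0 \<le> X y" and \<mu>: "0 \<le> \<mu>"
    and sq: "(\<integral>\<^sup>+ y. ennreal ((X y)\<^sup>2) \<partial>M) \<le> ennreal s" and s: "0 \<le> s" and c: "0 \<le> c"
    and nonneg: "\<And>y. 0 \<le> a + b * X y + c * (X y)\<^sup>2"
  shows "(\<integral>\<^sup>+ y. ennreal (a + b * X y + c * (X y)\<^sup>2) \<partial>M) \<le> ennreal (a + b * \<mu> + c * s)"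
proof -
  have int: "integrable M X"
    using X mean by (intro integrableI_nonneg) auto
  have int2: "integrable M (\<lambda>y. (X y)\<^sup>2)"
    using sq by (intro integrableI_nonneg) (auto simp: order_le_less_trans)
  have "ennreal (\<integral>y. X y \<partial>M) = ennreal \<mu>"
    using nn_integral_eq_integral[OF int] X mean by simp
  moreover have "0 \<le> (\<integral>y. X y \<partial>M)"
    using X by simp
  ultimately have E: "(\<integral>y. X y \<partial>M) = \<mu>"
    using \<mu> by (simp add: ennreal_inj)
  have "ennreal (\<integral>y. (X y)\<^sup>2 \<partial>M) \<le> ennreal s"
    using nn_integral_eq_integral[OF int2] sq by simp
  then have E2: "(\<integral>y. (X y)\<^sup>2 \<partial>M) \<le> s"
    using s by simp
  have "(\<integral>\<^sup>+ y. ennreal (a + b * X y + c * (X y)\<^sup>2) \<partial>M) = ennreal (\<integral>y. a + b * X y + c * (X y)\<^sup>2 \<partial>M)"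
    using int int2 nonneg by (intro nn_integral_eq_integral) auto
  also have "(\<integral>y. a + b * X y + c * (X y)\<^sup>2 \<partial>M) = a + b * \<mu> + c * (\<integral>y. (X y)\<^sup>2 \<partial>M)"
    using int int2 by (simp add: E)
  also have "ennreal \<dots> \<le> ennreal (a + b * \<mu> + c * s)"
    using E2 c by (intro ennreal_leI add_left_mono mult_left_mono)
  finally show ?thesis .
qed

lemma ex_nat_less_le_Suc:
  fixes q :: real
  assumes "0 < q"
  obtains r :: nat where "real r < q" "q \<le> real r + 1"
proof
  let ?r = "nat (\<lceil>q\<rceil> - 1)"
  have "0 \<le> \<lceil>q\<rceil> - 1"
    using assms by simp
  then have "real ?r = of_int \<lceil>q\<rceil> - 1"
    by simp
  then show "real ?r < q" "q \<le> real ?r + 1"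
    by linarith+
qed

text \<open>The factor 2 makes up for the half of the mean that truncation may lose. The term
  \<open>33 / \<beta>\<close> pays per particle; the other two, times a mean of at least \<beta>,
  cover the fixed part \<open>14 + 8 / \<beta>\<close>.\<close>

definition time_slope :: "real \<Rightarrow> real" where
  "time_slope \<alpha> = 2 * (18 / beta \<alpha> + 8 / (beta \<alpha>)\<^sup>2 + 33 / beta \<alpha>)"

context graph_queries begin

context
  fixes \<alpha> :: real
  assumes \<alpha>: "0 < \<alpha>" "\<alpha> < 1"
begin

lemma beta_bounds: "0 < beta \<alpha>" "beta \<alpha> < 1"
  using \<alpha> by (auto simp: beta_def field_simps)

lemma survival_bounds: "0 < survival \<alpha>" "survival \<alpha> < 1"
  using \<alpha> by (auto simp: survival_def)

lemma beta_survival: "(1 - beta \<alpha>) * survival \<alpha> = 1 - \<alpha>"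
  using \<alpha> by (simp add: beta_def survival_def field_simps)

abbreviation mu :: real where "mu \<equiv> trial_mean \<alpha> (beta \<alpha>)"

lemmas trial_params = \<alpha> beta_bounds survival_bounds beta_survival

lemma n_pos: "0 < real n"
  using target finite_verts by (auto simp: card_gt_0_iff)

lemma mu_pos: "0 < mu" "beta \<alpha> \<le> mu"
  using trial_mean_ge[OF trial_params] beta_bounds by auto

lemma mu_le: "mu \<le> real n"
proof -
  have "mu \<le> beta \<alpha> / \<alpha> * real n"
    by (rule trial_mean_le[OF trial_params])
  also have "\<dots> \<le> 1 * real n"
    using \<alpha> by (intro mult_right_mono) (auto simp: beta_def field_simps)
  finally show ?thesis by simp
qed

lemma trial_quadratic_le:
  assumes "0 \<le> c" "\<And>l :: nat. 0 \<le> a + b * real l + c * (real l)\<^sup>2"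
  shows "(\<integral>\<^sup>+ ys. ennreal (a + b * real (length ys) + c * (real (length ys))\<^sup>2)
      \<partial>trial Q (survival \<alpha>) (beta \<alpha>) [t]) \<le> ennreal (a + b * mu + c * (2 / \<alpha> * real n * mu))"
proof (rule nn_integral_quadratic_le)
  show "(\<integral>\<^sup>+ ys. ennreal (real (length ys)) \<partial>trial Q (survival \<alpha>) (beta \<alpha>) [t]) = ennreal mu"
    by (rule nn_integral_length_trial[OF trial_params])
  have "real n / (1 - survival \<alpha>) * mu = 2 / \<alpha> * real n * mu"
    using \<alpha> by (simp add: survival_def field_simps)
  then show "(\<integral>\<^sup>+ ys. ennreal ((real (length ys))\<^sup>2) \<partial>trial Q (survival \<alpha>) (beta \<alpha>) [t]) \<le>
      ennreal (2 / \<alpha> * real n * mu)"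
    using nn_integral_length_sq_trial[OF trial_params] by simp
qed (use assms \<alpha> mu_pos in auto)

lemma pagerank_eq: "pagerank \<alpha> G t = mu * (2 - \<alpha>) / (real n * (if 0 < d t then 1 else \<alpha>))"
  unfolding trial_mean_def[OF trial_params]
  using \<alpha> n_pos by (auto simp: stop_prob_def beta_def field_simps)

lemma inv0_input: "inv0 n t \<alpha> (input n t \<alpha> \<epsilon> p)" "nmem (input n t \<alpha> \<epsilon> p) 2 = 0" "nmem (input n t \<alpha> \<epsilon> p) 3 = 0"
  by (simp_all add: inv0_def input_def)

text \<open>The term \<open>4 * n / \<alpha>\<close> in the potential makes up for the trials that overshoot the threshold
  \<open>K * n\<close>: by the second moment bound, truncating a trial at that size loses at most half of its mean.\<close>

lemma expected_time_pagerank_com: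
  "expected_time Q (pagerank_com K) (input n t \<alpha> \<epsilon> p) \<le>
     ennreal (4 + time_slope \<alpha> * ((real K + 4 / \<alpha>) * real n))"
proof -
  define A D where "A = time_slope \<alpha>" and "D = 4 / \<alpha> * real n"
  let ?\<beta> = "beta \<alpha>" and ?N = "real K * real n"
  have A: "0 < A" and D: "0 < D"
    using beta_bounds \<alpha> n_pos by (auto simp: A_def time_slope_def D_def intro!: add_pos_pos)
  define V where "V S = A * max 0 (?N + D - S)" for S
  have V: "0 \<le> V S" for S
    using A by (simp add: V_def)
  \<comment> \<open>As \<open>S < N\<close>, at least \<open>D\<close> is left, so a trial of size
    \<open>l\<close> lowers the maximum by at least \<open>min l D\<close>. The quadratic minorant
    \<open>l - l^2 / D\<close> has a mean that the first two moments control.\<close>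
  have V_step: "V (S + l) \<le> V S - A * l + A / D * l\<^sup>2" if "S < ?N" "0 \<le> l" for S l
  proof -
    have "l - l\<^sup>2 / D \<le> min l D"
    proof (cases "l \<le> D")
      case False
      then have "l * D \<le> l\<^sup>2"
        using that by (simp add: power2_eq_square mult_left_mono)
      then have "l - l\<^sup>2 / D \<le> 0"
        using D by (simp add: field_simps)
      then show ?thesis
        using D that by simp
    qed (use D in simp)
    moreover have "max 0 (?N + D - (S + l)) \<le> max 0 (?N + D - S) - min l D"
      using that by (auto simp: max_def min_def)
    ultimately have "max 0 (?N + D - (S + l)) \<le> max 0 (?N + D - S) - l + l\<^sup>2 / D"
      by linarith
    then have "A * max 0 (?N + D - (S + l)) \<le> A * (max 0 (?N + D - S) - l + l\<^sup>2 / D)"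
      using A by (intro mult_left_mono) auto
    then show ?thesis
      by (simp add: V_def algebra_simps)
  qed
  define \<Phi> :: "nat \<Rightarrow> nat \<Rightarrow> ennreal" where "\<Phi> S R = ennreal (4 + V (real S))" for S R
  have "ert Q 1 (pagerank_com K) (\<lambda>m. (\<lambda>_. 0) (rmem m 0)) (input n t \<alpha> \<epsilon> p) \<le> \<Phi> 0 0"
  proof (rule ert_pagerank_com[where \<Phi> = \<Phi> and g = "\<lambda>_. 0", OF beta_bounds _ _ inv0_input])
    fix S R :: nat assume "real K * real n \<le> real S"
    have "4 * 1 + 0 \<le> ennreal 4"
      by simp
    also have "\<dots> \<le> \<Phi> S R"
      unfolding \<Phi>_def using V by (intro ennreal_leI) auto
    finally show "4 * 1 + 0 \<le> \<Phi> S R" .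
  next
    fix S R :: nat assume S: "real S < ?N"
    define a b c where "a = 9 + 8 / ?\<beta> + V (real S)" and "b = 33 / ?\<beta> - A" and "c = A / D"
    have pw: "9 + V (real (S + l)) + (8 / ?\<beta> + 33 / ?\<beta> * real l) \<le> a + b * real l + c * (real l)\<^sup>2" for l
      using V_step[OF S, of "real l"] by (simp add: a_def b_def c_def algebra_simps)
    have cost: "0 \<le> 8 / ?\<beta> + 33 / ?\<beta> * real l" for l
      using beta_bounds by simp
    have "9 * 1 + trial_value Q 1 \<alpha> (\<lambda>l S R. 5 * 1 + \<Phi> (S + l) (Suc R)) S R [t] =
      9 + (\<integral>\<^sup>+ ys. ennreal (9 + V (real (S + length ys)) + (8 / ?\<beta> + 33 / ?\<beta> * real (length ys)))
        \<partial>trial Q (survival \<alpha>) ?\<beta> [t])"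
    proof -
      have "5 * 1 + \<Phi> (S + l) (Suc R) + ennreal (8 / ?\<beta> + 33 / ?\<beta> * real l) * 1 =
        ennreal (9 + V (real (S + l)) + (8 / ?\<beta> + 33 / ?\<beta> * real l))" for l
      proof -
        have "ennreal (9 + V (real (S + l)) + (8 / ?\<beta> + 33 / ?\<beta> * real l)) =
            ennreal (5 + (4 + V (real (S + l)))) + ennreal (8 / ?\<beta> + 33 / ?\<beta> * real l)"
          using V cost[of l] by (subst ennreal_plus[symmetric]) auto
        also have "ennreal (5 + (4 + V (real (S + l)))) = 5 + ennreal (4 + V (real (S + l)))"
          using V by (subst ennreal_plus) auto
        finally show ?thesis
          by (simp only: \<Phi>_def mult_1_right mult_1)
      qed
      then show ?thesis
        by (simp only: trial_value_def mult_1_right)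
    qed
    also have "\<dots> \<le> 9 + (\<integral>\<^sup>+ ys. ennreal (a + b * real (length ys) + c * (real (length ys))\<^sup>2)
        \<partial>trial Q (survival \<alpha>) ?\<beta> [t])"
      by (intro add_left_mono nn_integral_mono ennreal_leI pw)
    also have "\<dots> \<le> 9 + ennreal (a + b * mu + c * (2 / \<alpha> * real n * mu))"
    proof (intro add_left_mono trial_quadratic_le)
      show "0 \<le> c"
        using A D by (simp add: c_def)
      show "0 \<le> a + b * real l + c * (real l)\<^sup>2" for l
        using pw[of l] V[of "real (S + l)"] cost[of l] by linarith
    qed
    also have "\<dots> \<le> \<Phi> S R"
    proof -
      have c\<sigma>: "c * (2 / \<alpha> * real n * mu) = A * mu / 2"
        using \<alpha> n_pos by (simp add: c_def D_def field_simps)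
      note c\<sigma>
      moreover have "14 + 8 / ?\<beta> \<le> (18 / ?\<beta> + 8 / ?\<beta>\<^sup>2) * mu"
      proof -
        have "14 + 8 / ?\<beta> \<le> (18 / ?\<beta> + 8 / ?\<beta>\<^sup>2) * ?\<beta>"
          using beta_bounds by (simp add: field_simps power2_eq_square)
        also have "\<dots> \<le> (18 / ?\<beta> + 8 / ?\<beta>\<^sup>2) * mu"
          using mu_pos beta_bounds by (intro mult_left_mono) auto
        finally show ?thesis .
      qed
      moreover have "A * mu / 2 = (18 / ?\<beta> + 8 / ?\<beta>\<^sup>2) * mu + 33 / ?\<beta> * mu"
        by (simp add: A_def time_slope_def algebra_simps)
      ultimately have le: "9 + (a + b * mu + c * (2 / \<alpha> * real n * mu)) \<le> 4 + V (real S)"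
        unfolding a_def b_def left_diff_distrib by argo
      have "0 \<le> a + b * mu + c * (2 / \<alpha> * real n * mu)"
      proof -
        have "A * mu \<le> V (real S)"
        proof -
          have "mu \<le> real n * 1"
            using mu_le by simp
          also have "\<dots> \<le> real n * (4 / \<alpha>)"
            using \<alpha> by (intro mult_left_mono) (auto simp: field_simps)
          finally have "mu \<le> max 0 (?N + D - real S)"
            using S by (simp add: D_def mult.commute)
          then show ?thesis
            unfolding V_def using A by (intro mult_left_mono) auto
        qed
        moreover have "0 \<le> A * mu" "0 \<le> 8 / ?\<beta>" "0 \<le> 33 / ?\<beta> * mu"
          using A mu_pos beta_bounds by simp_all
        ultimately show ?thesis
          unfolding a_def b_def left_diff_distrib c\<sigma> by argo
      qed
      then have "9 + ennreal (a + b * mu + c * (2 / \<alpha> * real n * mu)) =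
          ennreal (9 + (a + b * mu + c * (2 / \<alpha> * real n * mu)))"
        by simp
      also have "\<dots> \<le> \<Phi> S R"
        unfolding \<Phi>_def using le by (rule ennreal_leI)
      finally show ?thesis .
    qed
    finally show "9 * 1 + trial_value Q 1 \<alpha> (\<lambda>l S R. 5 * 1 + \<Phi> (S + l) (Suc R)) S R [t] \<le> \<Phi> S R" .
  qed
  also have "\<Phi> 0 0 = ennreal (4 + time_slope \<alpha> * ((real K + 4 / \<alpha>) * real n))"
    using D by (simp add: \<Phi>_def V_def A_def D_def algebra_simps)
  finally show ?thesis
    using expected_time_le_ert[of Q "pagerank_com K" "input n t \<alpha> \<epsilon> p"] by simp
qed

text \<open>The potential is Kolmogorov's: as long as the run is not decided, the squared deviation of the
  total from its mean plus the variance of the trials that may still follow is a supermartingale, and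
  it is at least \<open>(\<epsilon> * K * n / 2)\<^sup>2\<close> whenever the run stops too early or reaches the last
  admissible trial \<open>r\<close>.\<close>

lemma output_prob_pagerank_com:
  assumes \<epsilon>: "0 < \<epsilon>" "\<epsilon> < 1" and p: "0 < p"
    and K: "2 / \<epsilon> \<le> real K" "8 / ((1 - \<epsilon>) * \<alpha> * \<epsilon>\<^sup>2 * p) \<le> real K"
  shows "output_prob Q (pagerank_com K) (input n t \<alpha> \<epsilon> p)
    {x. \<bar>x - pagerank \<alpha> G t\<bar> \<ge> \<epsilon> * pagerank \<alpha> G t} \<le> p"
proof -
  define \<mu> where "\<mu> = mu"
  define N \<Delta> v A where "N = real K * real n" and "\<Delta> = \<epsilon> * N / 2" and "v = 2 / \<alpha> * real n * \<mu>"
    and "A = {x. \<bar>x - pagerank \<alpha> G t\<bar> \<ge> \<epsilon> * pagerank \<alpha> G t}"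
  have \<mu>: "0 < \<mu>" "\<mu> \<le> real n"
    using mu_pos mu_le by (auto simp: \<mu>_def)
  have "0 < 2 / \<epsilon>"
    using \<epsilon> by simp
  then have K0: "0 < real K"
    using K(1) by linarith
  have N: "0 < N" and \<Delta>: "0 < \<Delta>" and v: "0 < v"
    using K0 n_pos \<epsilon> \<mu> \<alpha> by (simp_all add: N_def \<Delta>_def v_def)
  have \<mu>_le: "\<mu> \<le> \<Delta>"
  proof -
    have "1 \<le> \<epsilon> * real K / 2"
      using K(1) \<epsilon> by (simp add: field_simps)
    then have "1 * real n \<le> \<epsilon> * real K / 2 * real n"
      by (intro mult_right_mono) auto
    moreover have "\<Delta> = \<epsilon> * real K / 2 * real n"
      by (simp add: \<Delta>_def N_def)
    ultimately show ?thesis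
      using \<mu> by linarith
  qed
  have "0 < N / ((1 - \<epsilon>) * \<mu>)"
    using N \<epsilon> \<mu> by simp
  \<comment> \<open>After \<open>R\<close> trials the estimate is \<open>N / (R * \<mu>)\<close>
    times the true value, so \<open>r\<close> is the largest number of trials for which it is not
    too low by the fraction \<epsilon>.\<close>
  then obtain r :: nat where r: "real r < N / ((1 - \<epsilon>) * \<mu>)" "N / ((1 - \<epsilon>) * \<mu>) \<le> real r + 1"
    by (rule ex_nat_less_le_Suc)
  have r_less: "(1 - \<epsilon>) * (real r * \<mu>) < N"
    using r(1) \<epsilon> \<mu> by (simp add: field_simps)
  have r_ge: "N \<le> (1 - \<epsilon>) * ((real r + 1) * \<mu>)"
    using r(2) \<epsilon> \<mu> by (simp add: field_simps)
  \<comment> \<open>The defining inequality gives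
    \<open>(1 + \<epsilon>) * N \<le> (r + 1) * \<mu>\<close>; the surplus trial costs \<mu>, at
    most half of the gap \<open>\<epsilon> * N\<close>. This is where
    \<open>K \<ge> 2 / \<epsilon>\<close> enters.\<close>
  have rm: "N + \<Delta> \<le> real r * \<mu>"
  proof -
    have "(1 + \<epsilon>) * N \<le> (1 + \<epsilon>) * ((1 - \<epsilon>) * ((real r + 1) * \<mu>))"
      using r_ge \<epsilon> by (intro mult_left_mono) auto
    also have "\<dots> = (1 - \<epsilon>\<^sup>2) * ((real r + 1) * \<mu>)"
      by (simp add: power2_eq_square algebra_simps)
    also have "\<dots> \<le> 1 * ((real r + 1) * \<mu>)"
      using \<mu> by (intro mult_right_mono) auto
    finally have "N + \<epsilon> * N \<le> real r * \<mu> + \<mu>"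
      by (simp add: algebra_simps)
    then show ?thesis
      using \<mu>_le by (simp add: \<Delta>_def)
  qed
  have r_pos: "0 < r"
    using rm N \<Delta> by (cases "r = 0") auto
  \<comment> \<open>Up to \<open>r\<close> trials a bad estimate can only be too high, so
    \<open>(1 + \<epsilon>) * R * \<mu> \<le> N\<close>. The factor
    \<open>1 - \<epsilon> / 2\<close> turns this into an additive gap, as
    \<open>(1 - \<epsilon> / 2) * (1 + \<epsilon>) \<ge> 1\<close>.\<close>
  have early: "real R * \<mu> + \<Delta> \<le> N" if "estimate Q t \<alpha> K R \<in> A" "0 < R" "R \<le> r" for R
  proof -
    have \<pi>: "0 < pagerank \<alpha> G t"
      unfolding pagerank_eq using \<alpha> n_pos mu_pos by simp
    have est: "estimate Q t \<alpha> K R = N / (real R * \<mu>) * pagerank \<alpha> G t"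
      unfolding pagerank_eq using \<alpha> n_pos mu_pos that
      by (simp add: estimate_def N_def \<mu>_def field_simps)
    have "\<epsilon> * pagerank \<alpha> G t \<le> \<bar>(N / (real R * \<mu>) - 1) * pagerank \<alpha> G t\<bar>"
      using that(1) by (simp add: A_def est algebra_simps)
    then have dev: "\<epsilon> \<le> \<bar>N / (real R * \<mu>) - 1\<bar>"
      using \<pi> by (simp add: abs_mult)
    have pos: "0 < real R * \<mu>"
      using that \<mu> by simp
    have "(1 - \<epsilon>) * (real R * \<mu>) \<le> (1 - \<epsilon>) * (real r * \<mu>)"
      using that \<epsilon> \<mu> by (intro mult_left_mono mult_right_mono) auto
    then have "1 - \<epsilon> < N / (real R * \<mu>)"
      using r_less pos by (simp add: pos_less_divide_eq)
    then have "1 + \<epsilon> \<le> N / (real R * \<mu>)"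
      using dev by (simp add: abs_if split: if_splits)
    then have "(1 + \<epsilon>) * (real R * \<mu>) \<le> N"
      using pos by (simp add: pos_le_divide_eq)
    then have "(1 - \<epsilon> / 2) * ((1 + \<epsilon>) * (real R * \<mu>)) \<le> (1 - \<epsilon> / 2) * N"
      using \<epsilon> by (intro mult_left_mono) auto
    moreover have "1 * (real R * \<mu>) \<le> ((1 - \<epsilon> / 2) * (1 + \<epsilon>)) * (real R * \<mu>)"
    proof (rule mult_right_mono)
      have "0 \<le> \<epsilon> * (1 - \<epsilon>) / 2"
        using \<epsilon> by simp
      then show "1 \<le> (1 - \<epsilon> / 2) * (1 + \<epsilon>)"
        by (simp add: algebra_simps)
    qed (use pos in simp)
    ultimately show ?thesis
      by (simp add: \<Delta>_def algebra_simps)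
  qed
  define \<psi> where "\<psi> s R = ((s - real R * \<mu>)\<^sup>2 + (real r - real R) * v) / \<Delta>\<^sup>2" for s R
  have \<psi>_ge_1: "1 \<le> \<psi> s R" if "R \<le> r" "\<Delta> \<le> \<bar>s - real R * \<mu>\<bar>" for s R
  proof -
    have "\<Delta>\<^sup>2 \<le> (s - real R * \<mu>)\<^sup>2"
      using that \<Delta> by (simp add: abs_le_square_iff[symmetric])
    moreover have "0 \<le> (real r - real R) * v"
      using that v by simp
    ultimately show ?thesis
      using \<Delta> by (simp add: \<psi>_def)
  qed
  have \<psi>_nonneg: "0 \<le> \<psi> s R" if "R \<le> r" for s R
    using that v by (simp add: \<psi>_def)
  \<comment> \<open>Past the threshold the outcome is known; a run still below it after
    \<open>r\<close> trials is written off as a failure.\<close>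
  define \<Phi> :: "nat \<Rightarrow> nat \<Rightarrow> ennreal" where
    "\<Phi> S R = (if N \<le> real S then indicator A (estimate Q t \<alpha> K R)
       else if r \<le> R then 1 else ennreal (\<psi> (real S) R))" for S R
  have \<Phi>_le: "\<Phi> S R \<le> ennreal (\<psi> (real S) R)" if "0 < R" "R \<le> r" for S R
  proof -
    have one: "1 \<le> ennreal (\<psi> (real S) R)" if "\<Delta> \<le> \<bar>real S - real R * \<mu>\<bar>"
      using \<psi>_ge_1[OF \<open>R \<le> r\<close> that] by simp
    show ?thesis
    proof (cases "N \<le> real S")
      case True
      show ?thesis
      proof (cases "estimate Q t \<alpha> K R \<in> A")
        case bad: True
        have "\<Delta> \<le> \<bar>real S - real R * \<mu>\<bar>"
          using early[OF bad that] True by linarith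
        then show ?thesis
          using True bad one by (simp add: \<Phi>_def)
      qed (simp add: \<Phi>_def True)
    next
      case False
      show ?thesis
      proof (cases "R = r")
        case True
        have "\<Delta> \<le> \<bar>real S - real R * \<mu>\<bar>"
          using rm False unfolding True by linarith
        then show ?thesis
          using True False one by (simp add: \<Phi>_def)
      qed (use that False in \<open>simp add: \<Phi>_def\<close>)
    qed
  qed
  have "ert Q 0 (pagerank_com K) (\<lambda>m. indicator A (rmem m 0)) (input n t \<alpha> \<epsilon> p) \<le> \<Phi> 0 0"
  proof (rule ert_pagerank_com[where \<Phi> = \<Phi> and g = "indicator A", OF beta_bounds _ _ inv0_input])
    fix S R :: nat
    assume "real K * real n \<le> real S"
    then show "4 * 0 + indicator A (estimate Q t \<alpha> K R) \<le> \<Phi> S R"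
      by (simp add: \<Phi>_def N_def)
  next
    fix S R :: nat
    assume S: "real S < real K * real n"
    have "9 * 0 + trial_value Q 0 \<alpha> (\<lambda>l S R. 5 * 0 + \<Phi> (S + l) (Suc R)) S R [t] =
        (\<integral>\<^sup>+ ys. \<Phi> (S + length ys) (Suc R) \<partial>trial Q (survival \<alpha>) (beta \<alpha>) [t])"
      by (simp add: trial_value_def)
    also have "\<dots> \<le> \<Phi> S R"
    proof (cases "r \<le> R")
      case True
      have "(\<integral>\<^sup>+ ys. \<Phi> (S + length ys) (Suc R) \<partial>trial Q (survival \<alpha>) (beta \<alpha>) [t]) \<le>
          (\<integral>\<^sup>+ ys. 1 \<partial>trial Q (survival \<alpha>) (beta \<alpha>) [t])"
        using True by (intro nn_integral_mono) (auto simp: \<Phi>_def indicator_def)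
      then show ?thesis
        using True S by (simp add: \<Phi>_def N_def)
    next
      case False
      define s where "s = real S - real (Suc R) * \<mu>"
      define a where "a = (s\<^sup>2 + (real r - real (Suc R)) * v) / \<Delta>\<^sup>2"
      have \<psi>: "\<psi> (real (S + l)) (Suc R) = a + 2 * s / \<Delta>\<^sup>2 * real l + 1 / \<Delta>\<^sup>2 * (real l)\<^sup>2" for l
      proof -
        have "(real (S + l) - real (Suc R) * \<mu>)\<^sup>2 = s\<^sup>2 + 2 * s * real l + (real l)\<^sup>2"
          by (simp add: s_def power2_eq_square algebra_simps)
        then show ?thesis
          by (simp only: \<psi>_def a_def) (simp add: add_divide_distrib)
      qed
      have "(\<integral>\<^sup>+ ys. \<Phi> (S + length ys) (Suc R) \<partial>trial Q (survival \<alpha>) (beta \<alpha>) [t]) \<le>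
          (\<integral>\<^sup>+ ys. ennreal (\<psi> (real (S + length ys)) (Suc R)) \<partial>trial Q (survival \<alpha>) (beta \<alpha>) [t])"
        using False by (intro nn_integral_mono \<Phi>_le) auto
      also have "\<dots> \<le> ennreal (a + 2 * s / \<Delta>\<^sup>2 * mu + 1 / \<Delta>\<^sup>2 * (2 / \<alpha> * real n * mu))"
        unfolding \<psi>
      proof (rule trial_quadratic_le)
        show "0 \<le> a + 2 * s / \<Delta>\<^sup>2 * real l + 1 / \<Delta>\<^sup>2 * (real l)\<^sup>2" for l
          unfolding \<psi>[symmetric] using False by (intro \<psi>_nonneg) simp
      qed simp
      also have "\<dots> \<le> ennreal (\<psi> (real S) R)"
      proof (rule ennreal_leI)
        have "(real S - real R * \<mu>)\<^sup>2 = s\<^sup>2 + 2 * s * \<mu> + \<mu>\<^sup>2"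
          by (simp add: s_def power2_eq_square algebra_simps)
        \<comment> \<open>Since \<open>v\<close> bounds the uncentred second moment rather than the
          variance, \<open>\<mu>^2 / \<Delta>^2\<close> is left over.\<close>
        then have "\<psi> (real S) R = (s\<^sup>2 + 2 * s * \<mu> + (real r - real (Suc R)) * v + v) / \<Delta>\<^sup>2 + \<mu>\<^sup>2 / \<Delta>\<^sup>2"
          by (simp add: \<psi>_def algebra_simps flip: add_divide_distrib)
        moreover have "a + 2 * s / \<Delta>\<^sup>2 * mu + 1 / \<Delta>\<^sup>2 * (2 / \<alpha> * real n * mu) =
            (s\<^sup>2 + 2 * s * \<mu> + (real r - real (Suc R)) * v + v) / \<Delta>\<^sup>2"
          unfolding \<mu>_def[symmetric] v_def[symmetric] a_def by (simp add: add_divide_distrib)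
        ultimately show "a + 2 * s / \<Delta>\<^sup>2 * mu + 1 / \<Delta>\<^sup>2 * (2 / \<alpha> * real n * mu) \<le> \<psi> (real S) R"
          by simp
      qed
      also have "\<dots> = \<Phi> S R"
        using False S by (simp add: \<Phi>_def N_def)
      finally show ?thesis .
    qed
    finally show "9 * 0 + trial_value Q 0 \<alpha> (\<lambda>l S R. 5 * 0 + \<Phi> (S + l) (Suc R)) S R [t] \<le> \<Phi> S R" .
  qed
  also have "\<Phi> 0 0 = ennreal (real r * v / \<Delta>\<^sup>2)"
    using N r_pos by (simp add: \<Phi>_def \<psi>_def)
  also have "\<dots> \<le> ennreal p"
  proof (rule ennreal_leI)
    \<comment> \<open>Here \<mu> and \<open>n\<close> cancel, which is why \<open>K\<close> can be
      chosen independently of the graph.\<close>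
    have "real r * v / \<Delta>\<^sup>2 \<le> N / ((1 - \<epsilon>) * \<mu>) * v / \<Delta>\<^sup>2"
      using r(1) v by (intro divide_right_mono mult_right_mono) auto
    also have "\<dots> = 8 / ((1 - \<epsilon>) * \<alpha> * \<epsilon>\<^sup>2 * real K)"
      using \<epsilon> \<mu> n_pos K0 \<alpha> by (simp add: N_def v_def \<Delta>_def power2_eq_square divide_simps)
    also have "\<dots> \<le> p"
    proof -
      define w where "w = (1 - \<epsilon>) * \<alpha> * \<epsilon>\<^sup>2"
      have "0 < w"
        using \<epsilon> \<alpha> by (simp add: w_def)
      then show ?thesis
        using K(2) p K0 unfolding w_def[symmetric] by (simp add: field_simps)
    qed
    finally show "real r * v / \<Delta>\<^sup>2 \<le> p" .
  qed
  finally show ?thesis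
    using p unfolding A_def by (intro output_prob_le_ert) auto
qed

end
end

theorem theorem6p2:
  fixes \<alpha> \<epsilon> p\<^sub>f :: real
  assumes "0 < \<alpha>" "\<alpha> < 1"
    and "0 < \<epsilon>" "\<epsilon> < 1"
    and "0 < p\<^sub>f" "p\<^sub>f < 1"
  shows "\<exists>(algo :: com) (T :: nat \<Rightarrow> real). T \<in> soft_O (\<lambda>n. real n) \<and>
    (\<forall>(G :: nat pair_pre_digraph) (Q :: graph_access) (t :: nat).
       pair_fin_digraph G \<longrightarrow> adjacency_access G Q \<longrightarrow> t \<in> pverts G \<longrightarrow>
       (let n = card (pverts G); m = input n t \<alpha> \<epsilon> p\<^sub>f
        in expected_time Q algo m \<le> ennreal (T n) \<and>
           output_prob Q algo m
             {x. \<bar>x - pagerank \<alpha> G t\<bar> \<ge> \<epsilon> * pagerank \<alpha> G t} \<le> p\<^sub>f))"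
proof -
  \<comment> \<open>The first bound absorbs the rounding of the number of trials, the second brings
    the failure probability below \<open>p\<^sub>f\<close>.\<close>
  define K where "K = nat \<lceil>max (2 / \<epsilon>) (8 / ((1 - \<epsilon>) * \<alpha> * \<epsilon>\<^sup>2 * p\<^sub>f))\<rceil>"
  have K: "2 / \<epsilon> \<le> real K" "8 / ((1 - \<epsilon>) * \<alpha> * \<epsilon>\<^sup>2 * p\<^sub>f) \<le> real K"
    unfolding K_def by linarith+
  define C where "C = time_slope \<alpha> * (real K + 4 / \<alpha>)"
  define T where "T n = 4 + C * real n" for n
  \<comment> \<open>The time bound is linear, so exponent 0 of the logarithm suffices.\<close>
  have "T \<in> O(\<lambda>n. real n * ln (real n) ^ 0)"
  proof (rule bigoI)
    show "\<forall>\<^sub>F n in sequentially. norm (T n) \<le> (4 + \<bar>C\<bar>) * norm (real n * ln (real n) ^ 0)"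
      using eventually_ge_at_top[of 1]
    proof eventually_elim
      case (elim n)
      have "norm (T n) \<le> 4 + \<bar>C\<bar> * real n"
        using abs_triangle_ineq[of 4 "C * real n"] by (simp add: T_def abs_mult)
      also have "\<dots> \<le> (4 + \<bar>C\<bar>) * real n"
        using elim by (simp add: algebra_simps)
      finally show ?case
        by simp
    qed
  qed
  then have "T \<in> soft_O (\<lambda>n. real n)"
    unfolding soft_O_def by blast
  moreover have "expected_time Q (pagerank_com K) (input (card (pverts G)) t \<alpha> \<epsilon> p\<^sub>f) \<le> ennreal (T (card (pverts G))) \<and>
      output_prob Q (pagerank_com K) (input (card (pverts G)) t \<alpha> \<epsilon> p\<^sub>f)
        {x. \<bar>x - pagerank \<alpha> G t\<bar> \<ge> \<epsilon> * pagerank \<alpha> G t} \<le> p\<^sub>f"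
    if "pair_fin_digraph G" "adjacency_access G Q" "t \<in> pverts G" for G Q t
  proof -
    interpret graph_queries G Q t
      using that by (rule graph_queries.intro)
    show ?thesis
      using expected_time_pagerank_com[OF assms(1,2)] output_prob_pagerank_com[OF assms(1-5) K]
      by (simp add: T_def C_def mult.assoc)
  qed
  ultimately show ?thesis
    by (intro exI[of _ "pagerank_com K"] exI[of _ T]) (simp add: Let_def)
qed

end
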